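(* Assume that $A_0^i$ and $A_{22}^i$ are Hurwitz for all $i\in\mathcal I$, and let $\gamma_{11}<1$, $\gamma_{22}<1$ and $$\frac{\gamma_{12}\gamma_{21}}{(1-\gamma_{11})(1-\gamma_{22})}<1.$$ Then there exists $\varepsilon_5^*>0$ such that for all $\varepsilon\in(0,\varepsilon_5^* )$, for all sequences $(t_k)_{k\ge0}$ of event times, and for all sequences $(\sigma_k)_{k\ge0}$ in $\mathcal I$ and $(\nu_k)_{k\ge1}$ in $\mathcal J$, the singularly perturbed hybrid system (H) is globally asymptotically stable.
   Context: Setting. Let $n_x,n_z\ge1$, $n=n_x+n_z$, let $\varepsilon>0$ be a parameter and $\mathcal I,\mathcal J$ finite nonempty index sets. For each $i\in\mathcal I$, $\mathbf D^i$ is an $n\times n$ diagonal matrix with $n_z$ diagonal entries equal to $\varepsilon$ and the other $n_x$ equal to $1$ (positions may depend on $i$), and $S_i$ is a permutation matrix with $S_i\mathbf D^iS_i^\top=\mathrm{diag}(I_{n_x},\varepsilon I_{n_z})$. Let $\mathbf A^i\in\mathbb R^{n\times n}$ ($i\in\mathcal I$) and $\mathbf J^j\in\mathbb R^{n\times n}$ ($j\in\mathcal J$) be given (independent of $\varepsilon$), and set $A^i=S_i\mathbf A^iS_i^\top$, $J^{i\stackrel{j}{\to}i'}=S_{i'}\mathbf J^jS_i^\top$ for $i,i'\in\mathcal I$, $j\in\mathcal J$. Write in blocks of sizes $n_x,n_z$: $$A^i=\begin{pmatrix} A^i_{11} & A^i_{12} \\ A^i_{21} & A^i_{22} \end{pmatrix},$$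 with $A_{22}^i$ non-singular. Set $A_0^i=A_{11}^i-A_{12}^i(A_{22}^i)^{-1}A_{21}^i$, $B_1^i=A_{12}^i$, $B_2^i=(A_{22}^i)^{-1}A_{21}^iA_0^i$, $B_3^i=(A_{22}^i)^{-1}A_{21}^iA_{12}^i$, $$P_i=\begin{pmatrix} I_{n_x} & 0 \\ (A_{22}^i)^{-1}A_{21}^i & I_{n_z} \end{pmatrix},\qquad R^{i\stackrel{j}{\to}i'}=P_{i'}J^{i\stackrel{j}{\to}i'}P_i^{-1}=\begin{pmatrix} R_{11}^{i\stackrel{j}{\to}i'} & R_{12}^{i\stackrel{j}{\to}i'} \\ R_{21}^{i\stackrel{j}{\to}i'} & R_{22}^{i\stackrel{j}{\to}i'} \end{pmatrix}.$$ A sequence of event times is a strictly increasing unbounded sequence $0=t_0<t_1<\cdots$. Given such a sequence, modes $\sigma_k\in\mathcal I$ ($k\ge0$) and $\nu_k\in\mathcal J$ ($k\ge1$), system (H) with state $(x(t),y(t))\in\mathbb R^{n_x}\times\mathbb R^{n_z}$ is, for $t\in[t_k,t_{k+1})$, $k\in\mathbb N$, $$\dot x=A_0^{\sigma_k}x+B_1^{\sigma_k}y,\qquad \varepsilon\dot y=\varepsilon B_2^{\sigma_k}x+(A_{22}^{\sigma_k}+\varepsilon B_3^{\sigma_k})y,$$ and, for $k\ge1$, $\begin{pmatrix} x(t_k) \\ y(t_k) \end{pmatrix}=R^{\sigma_{k-1}\stackrel{\nu_k}{\to}\sigma_k}\begin{pmatrix} x(t_k^-) \\ y(t_k^-) \end{pmatrix}$,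 where $t_k^-$ denotes the left limit. Globally asymptotically stable means: the origin is Lyapunov stable (for every $\rho>0$ there is $\delta>0$ such that initial states at time $0$ of norm $<\delta$ give solutions of norm $<\rho$ for all $t\ge0$) and every solution tends to $0$ as $t\to\infty$. Constants. Since $A_0^i,A_{22}^i$ are Hurwitz, fix symmetric matrices $Q_s^i\ge I_{n_x}$, $Q_f^i\ge I_{n_z}$ and numbers $\lambda_s^i,\lambda_f^i>0$ with $A_0^{i\top}Q_s^i+Q_s^iA_0^i\le-2\lambda_s^iQ_s^i$ and $A_{22}^{i\top}Q_f^i+Q_f^iA_{22}^i\le-2\lambda_f^iQ_f^i$ for all $i\in\mathcal I$. With $\|\cdot\|$ the spectral norm and maxima over $i,i'\in\mathcal I$, $j\in\mathcal J$, put $$\gamma_{11}=\max\|(Q_s^{i'})^{1/2}R_{11}^{i\stackrel{j}{\to}i'}(Q_s^i)^{-1/2}\|,\quad \gamma_{12}=\max\|(Q_s^{i'})^{1/2}R_{12}^{i\stackrel{j}{\to}i'}(Q_f^i)^{-1/2}\|,$$ $$\gamma_{21}=\max\|(Q_f^{i'})^{1/2}R_{21}^{i\stackrel{j}{\to}i'}(Q_s^i)^{-1/2}\|,\quad \gamma_{22}=\max\|(Q_f^{i'})^{1/2}R_{22}^{i\stackrel{j}{\to}i'}(Q_f^i)^{-1/2}\|.$$ *)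

theory Defs
  imports "HOL-Analysis.Analysis"
begin

text \<open>
  Vectors of length \<open>n\<^sub>x + n\<^sub>z\<close> are indexed by the sum type \<open>'x + 'z\<close>; the left summand
  carries the first \<open>n\<^sub>x\<close> coordinates.
\<close>

definition join :: "real^'x \<Rightarrow> real^'z \<Rightarrow> real^('x::finite + 'z::finite)" where
  "join u v = (\<chi> k. case k of Inl a \<Rightarrow> u $ a | Inr b \<Rightarrow> v $ b)"

definition block11 :: "real^('x::finite + 'z::finite)^('x + 'z) \<Rightarrow> real^'x^'x" where
  "block11 M = (\<chi> r c. M $ Inl r $ Inl c)"

definition block12 :: "real^('x::finite + 'z::finite)^('x + 'z) \<Rightarrow> real^'z^'x" where
  "block12 M = (\<chi> r c. M $ Inl r $ Inr c)"

definition block21 :: "real^('x::finite + 'z::finite)^('x + 'z) \<Rightarrow> real^'x^'z" where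
  "block21 M = (\<chi> r c. M $ Inr r $ Inl c)"

definition block22 :: "real^('x::finite + 'z::finite)^('x + 'z) \<Rightarrow> real^'z^'z" where
  "block22 M = (\<chi> r c. M $ Inr r $ Inr c)"

definition from_blocks ::
  "real^'x^'x \<Rightarrow> real^'z^'x \<Rightarrow> real^'x^'z \<Rightarrow> real^'z^'z \<Rightarrow> real^('x::finite + 'z::finite)^('x + 'z)" where
  "from_blocks M11 M12 M21 M22 =
     (\<chi> r c. case r of
        Inl a \<Rightarrow> (case c of Inl a' \<Rightarrow> M11 $ a $ a' | Inr b' \<Rightarrow> M12 $ a $ b')
      | Inr b \<Rightarrow> (case c of Inl a' \<Rightarrow> M21 $ b $ a' | Inr b' \<Rightarrow> M22 $ b $ b'))"

definition permutation_matrix :: "real^'n^'n \<Rightarrow> bool" where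
  "permutation_matrix S \<longleftrightarrow>
     (\<exists>\<pi>. bij \<pi> \<and> S = (\<chi> r c. if c = \<pi> r then 1 else 0))"

definition scaling_matrix :: "'n set \<Rightarrow> real \<Rightarrow> real^'n^'n" where
  "scaling_matrix F \<epsilon> = (\<chi> r c. if r = c then (if r \<in> F then \<epsilon> else 1) else 0)"

definition Hurwitz :: "real^'n^'n \<Rightarrow> bool" where
  "Hurwitz M \<longleftrightarrow>
     (\<forall>(\<mu>::complex) v. v \<noteq> 0 \<and> map_matrix complex_of_real M *v v = \<mu> *s v \<longrightarrow> Re \<mu> < 0)"

definition symmetric_matrix :: "real^'n^'n \<Rightarrow> bool" where
  "symmetric_matrix M \<longleftrightarrow> transpose M = M"

definition psd :: "real^'n^'n \<Rightarrow> bool" where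
  "psd M \<longleftrightarrow> symmetric_matrix M \<and> (\<forall>v. 0 \<le> v \<bullet> (M *v v))"

definition loewner_le :: "real^'n^'n \<Rightarrow> real^'n^'n \<Rightarrow> bool" where
  "loewner_le M N \<longleftrightarrow> psd (N - M)"

text \<open>The principal square root; meaningful for positive semidefinite arguments only.\<close>

definition matrix_sqrt :: "real^'n^'n \<Rightarrow> real^'n^'n" where
  "matrix_sqrt M = (THE X. psd X \<and> X ** X = M)"

definition spectral_norm :: "real^'n^'m \<Rightarrow> real" where
  "spectral_norm M = onorm ((*v) M)"

definition mode_mat ::
  "('i \<Rightarrow> real^'n^'n) \<Rightarrow> ('i \<Rightarrow> real^'n^'n) \<Rightarrow> 'i \<Rightarrow> real^'n^'n" where
  "mode_mat S \<A> i = S i ** \<A> i ** transpose (S i)"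

definition jump_mat ::
  "('i \<Rightarrow> real^'n^'n) \<Rightarrow> ('j \<Rightarrow> real^'n^'n) \<Rightarrow> 'i \<Rightarrow> 'j \<Rightarrow> 'i \<Rightarrow> real^'n^'n" where
  "jump_mat S \<J> i j i' = S i' ** \<J> j ** transpose (S i)"

definition A0_mat :: "real^('x::finite + 'z::finite)^('x + 'z) \<Rightarrow> real^'x^'x" where
  "A0_mat A = block11 A - block12 A ** matrix_inv (block22 A) ** block21 A"

definition B1_mat :: "real^('x::finite + 'z::finite)^('x + 'z) \<Rightarrow> real^'z^'x" where
  "B1_mat A = block12 A"

definition B2_mat :: "real^('x::finite + 'z::finite)^('x + 'z) \<Rightarrow> real^'x^'z" where
  "B2_mat A = matrix_inv (block22 A) ** block21 A ** A0_mat A"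

definition B3_mat :: "real^('x::finite + 'z::finite)^('x + 'z) \<Rightarrow> real^'z^'z" where
  "B3_mat A = matrix_inv (block22 A) ** block21 A ** block12 A"

definition P_mat ::
  "real^('x::finite + 'z::finite)^('x + 'z) \<Rightarrow> real^('x + 'z)^('x + 'z)" where
  "P_mat A = from_blocks (mat 1) 0 (matrix_inv (block22 A) ** block21 A) (mat 1)"

definition R_mat ::
  "('i \<Rightarrow> real^('x::finite + 'z::finite)^('x + 'z)) \<Rightarrow> ('i \<Rightarrow> real^('x + 'z)^('x + 'z)) \<Rightarrow>
   ('j \<Rightarrow> real^('x + 'z)^('x + 'z)) \<Rightarrow> 'i \<Rightarrow> 'j \<Rightarrow> 'i \<Rightarrow> real^('x + 'z)^('x + 'z)" where
  "R_mat S \<A> \<J> i j i' =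
     P_mat (mode_mat S \<A> i') ** jump_mat S \<J> i j i' ** matrix_inv (P_mat (mode_mat S \<A> i))"

text \<open>
  The four constants \<open>\<gamma>\<close> are instances of the following: \<open>Qout\<close> weights the target block, \<open>Qin\<close>
  the source block, and \<open>Rb i j i'\<close> is a block of the jump matrix from mode \<open>i\<close> to mode \<open>i'\<close>.
\<close>

definition jump_gain ::
  "'i set \<Rightarrow> 'j set \<Rightarrow> ('i \<Rightarrow> real^'m^'m) \<Rightarrow> ('i \<Rightarrow> real^'n^'n) \<Rightarrow>
   ('i \<Rightarrow> 'j \<Rightarrow> 'i \<Rightarrow> real^'n^'m) \<Rightarrow> real" where
  "jump_gain I J Qout Qin Rb =
     Max {spectral_norm (matrix_sqrt (Qout i') ** Rb i j i' ** matrix_inv (matrix_sqrt (Qin i)))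
          | i j i'. i \<in> I \<and> j \<in> J \<and> i' \<in> I}"

definition event_times :: "(nat \<Rightarrow> real) \<Rightarrow> bool" where
  "event_times T \<longleftrightarrow> T 0 = 0 \<and> strict_mono T \<and> \<not> bdd_above (range T)"

text \<open>
  Only the values of \<open>x\<close> and \<open>y\<close> on \<open>{0..}\<close> matter. At an event time the flow equation holds for
  the right derivative.
\<close>

definition is_solution ::
  "real \<Rightarrow> ('i \<Rightarrow> real^('x::finite + 'z::finite)^('x + 'z)) \<Rightarrow>
   ('i \<Rightarrow> 'j \<Rightarrow> 'i \<Rightarrow> real^('x + 'z)^('x + 'z)) \<Rightarrow>
   (nat \<Rightarrow> real) \<Rightarrow> (nat \<Rightarrow> 'i) \<Rightarrow> (nat \<Rightarrow> 'j) \<Rightarrow>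
   (real \<Rightarrow> real^'x) \<Rightarrow> (real \<Rightarrow> real^'z) \<Rightarrow> bool" where
  "is_solution \<epsilon> A R T \<sigma> \<nu> x y \<longleftrightarrow>
     (\<forall>k. \<forall>t \<in> {T k..<T (Suc k)}. \<exists>x' y'.
        (x has_vector_derivative x') (at t within {T k..<T (Suc k)}) \<and>
        (y has_vector_derivative y') (at t within {T k..<T (Suc k)}) \<and>
        x' = A0_mat (A (\<sigma> k)) *v x t + B1_mat (A (\<sigma> k)) *v y t \<and>
        \<epsilon> *\<^sub>R y' = (\<epsilon> *\<^sub>R B2_mat (A (\<sigma> k))) *v x t
                  + (block22 (A (\<sigma> k)) + \<epsilon> *\<^sub>R B3_mat (A (\<sigma> k))) *v y t) \<and>
     (\<forall>k\<ge>1. \<exists>x\<^sub>m y\<^sub>m.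
        (x \<longlongrightarrow> x\<^sub>m) (at_left (T k)) \<and> (y \<longlongrightarrow> y\<^sub>m) (at_left (T k)) \<and>
        join (x (T k)) (y (T k)) = R (\<sigma> (k - 1)) (\<nu> k) (\<sigma> k) *v join x\<^sub>m y\<^sub>m)"

definition globally_asymptotically_stable ::
  "real \<Rightarrow> ('i \<Rightarrow> real^('x::finite + 'z::finite)^('x + 'z)) \<Rightarrow>
   ('i \<Rightarrow> 'j \<Rightarrow> 'i \<Rightarrow> real^('x + 'z)^('x + 'z)) \<Rightarrow>
   (nat \<Rightarrow> real) \<Rightarrow> (nat \<Rightarrow> 'i) \<Rightarrow> (nat \<Rightarrow> 'j) \<Rightarrow> bool" where
  "globally_asymptotically_stable \<epsilon> A R T \<sigma> \<nu> \<longleftrightarrow>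
     (\<forall>\<rho>>0. \<exists>\<delta>>0. \<forall>x y. is_solution \<epsilon> A R T \<sigma> \<nu> x y \<longrightarrow> norm (join (x 0) (y 0)) < \<delta> \<longrightarrow>
        (\<forall>t\<ge>0. norm (join (x t) (y t)) < \<rho>)) \<and>
     (\<forall>x y. is_solution \<epsilon> A R T \<sigma> \<nu> x y \<longrightarrow> ((\<lambda>t. join (x t) (y t)) \<longlongrightarrow> 0) at_top)"

end

theory Submission
  imports Defs
begin

text \<open>
  In the weighted norms \<open>qnorm Q v = sqrt (v \<bullet> Q v)\<close>, write \<open>W\<^sub>s\<close> and \<open>W\<^sub>f\<close> for the norms of the slow
  and the fast state. A jump multiplies the vector \<open>(W\<^sub>s, W\<^sub>f)\<close> by at most the nonnegative matrix
  of the gains \<open>\<gamma>\<close>, and the small-gain condition provides a weight \<open>\<beta>\<close> for which \<open>W\<^sub>s + \<beta> W\<^sub>f\<close>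
  contracts at jumps by a factor \<open>\<theta> < 1\<close>. No dwell time is available, so along the flow this sum may
  grow, but only by a factor \<open>1 + O(sqrt \<epsilon>)\<close>, however long the flow lasts. For small \<open>\<epsilon>\<close> the product
  of the two factors is still below \<open>1\<close>, which makes the sum decay geometrically in the number of events.
\<close>

section \<open>Square roots of symmetric matrices above the identity\<close>

lemma symmetric_flip:
  fixes Q :: "real^'n^'n"
  assumes "symmetric_matrix Q"
  shows "a \<bullet> (Q *v b) = (Q *v a) \<bullet> b"
  using assms by (metis dot_lmul_matrix symmetric_matrix_def vector_transpose_matrix)

text \<open>With z = X w, the form at w - s z has no constant term and the linear term -2 s |z|^2.
  For small s > 0 it would be negative unless z = 0.\<close>

lemma psd_zero_form:
  fixes X :: "real^'n^'n"
  assumes "psd X" "w \<bullet> (X *v w) = 0"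
  shows "X *v w = 0"
proof -
  have sym: "a \<bullet> (X *v b) = (X *v a) \<bullet> b" for a b
    using assms(1) by (simp add: psd_def symmetric_flip)
  define z where "z = X *v w"
  define B where "B = z \<bullet> (X *v z)"
  have B0: "B \<ge> 0" using assms(1) by (simp add: psd_def B_def)
  have ge: "0 \<le> - 2 * s * (z \<bullet> z) + s^2 * B" for s
  proof -
    have "0 \<le> (w - s *\<^sub>R z) \<bullet> (X *v (w - s *\<^sub>R z))"
      using assms(1) by (simp add: psd_def)
    also have "\<dots> = - 2 * s * (z \<bullet> z) + s^2 * B"
      using assms(2) sym[of w z]
      by (simp add: matrix_vector_mult_diff_distrib matrix_vector_mult_scaleR inner_diff
          power2_eq_square B_def flip: z_def) (simp add: algebra_simps)
    finally show ?thesis .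
  qed
  \<comment> \<open>This choice makes the right-hand side of \<open>ge\<close> equal to -s^2 (B +
    2), which forces s = 0; the added 1 avoids division by zero when \<open>B\<close>
    vanishes.\<close>
  define s where "s = (z \<bullet> z) / (B + 1)"
  have s0: "s \<ge> 0" using B0 by (simp add: s_def)
  have zz: "z \<bullet> z = s * (B + 1)" using B0 by (simp add: s_def)
  have "0 \<le> - 2 * s * (s * (B + 1)) + s^2 * B" using ge[of s] zz by simp
  also have "\<dots> = - (s^2 * (B + 2))" by (simp add: power2_eq_square algebra_simps)
  finally have "s^2 * (B + 2) \<le> 0" by simp
  hence "s = 0" using B0 by (smt (verit) mult_pos_pos zero_less_power2)
  hence "z \<bullet> z = 0" using zz by simp
  thus ?thesis by (simp add: z_def)
qed

text \<open>
  With \<open>D = X - Y\<close> one has \<open>X D + D Y = 0\<close>, and the trace of \<open>(X D + D Y) D\<close> is the sum of the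
  nonnegative traces of \<open>D X D\<close> and \<open>D Y D\<close>.
\<close>

lemma psd_sqrt_unique:
  fixes X Y :: "real^'n^'n"
  assumes X: "psd X" and Y: "psd Y" and sq: "X ** X = Y ** Y"
    and inj: "\<And>v. X *v v = 0 \<Longrightarrow> v = 0"
  shows "X = Y"
proof -
  define D where "D = X - Y"
  have symX: "transpose X = X" and symY: "transpose Y = Y"
    using X Y by (auto simp: psd_def symmetric_matrix_def)
  have "transpose D = D"
    using symX symY by (simp add: D_def transpose_def vec_eq_iff)
  hence Dflip: "a \<bullet> (D *v b) = (D *v a) \<bullet> b" for a b
    by (simp add: symmetric_flip symmetric_matrix_def)
  \<comment> \<open>The diagonal entries of \<open>D ** Z ** D\<close> are the values of the form of
    \<open>Z\<close> at the columns of \<open>D\<close>, so for positive semidefinite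
    \<open>Z\<close> the trace is a sum of nonnegative terms.\<close>
  have tr: "trace (D ** Z ** D) = (\<Sum>i\<in>UNIV. (D *v axis i 1) \<bullet> (Z *v (D *v axis i 1)))"
    for Z :: "real^'n^'n"
  proof -
    have "(D ** Z ** D) $ i $ i = (D *v axis i 1) \<bullet> (Z *v (D *v axis i 1))" for i
    proof -
      have "(D ** Z ** D) $ i $ i = axis i 1 \<bullet> ((D ** Z ** D) *v axis i 1)"
        by (simp add: inner_axis' matrix_vector_mul_component inner_axis)
      also have "\<dots> = (D *v axis i 1) \<bullet> (Z *v (D *v axis i 1))"
        by (simp add: Dflip flip: matrix_vector_mul_assoc)
      finally show ?thesis .
    qed
    thus ?thesis by (simp add: trace_def)
  qed
  have "X ** D + D ** Y = 0"
    using sq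
    by (simp add: D_def matrix_eq matrix_vector_mult_diff_distrib matrix_vector_mult_diff_rdistrib
        matrix_vector_mult_add_rdistrib flip: matrix_vector_mul_assoc)
  hence "trace ((X ** D + D ** Y) ** D) = 0" by (simp add: trace_def)
  \<comment> \<open>Cyclicity of the trace turns X D D into D X D.\<close>
  hence "trace (D ** X ** D) + trace (D ** Y ** D) = 0"
  proof -
    have "(X ** D + D ** Y) ** D = (X ** D) ** D + D ** Y ** D"
      by (simp add: matrix_eq matrix_vector_mult_add_rdistrib flip: matrix_vector_mul_assoc)
    thus ?thesis using \<open>trace ((X ** D + D ** Y) ** D) = 0\<close> trace_mul_sym[of "X ** D" D]
      by (simp add: trace_add matrix_mul_assoc)
  qed
  moreover have "trace (D ** X ** D) \<ge> 0" "trace (D ** Y ** D) \<ge> 0"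
    using X Y by (auto simp: tr psd_def intro!: sum_nonneg)
  ultimately have "trace (D ** X ** D) = 0" by linarith
  hence "(D *v axis i 1) \<bullet> (X *v (D *v axis i 1)) = 0" for i
    using X by (subst (asm) tr, subst (asm) sum_nonneg_eq_0_iff) (auto simp: psd_def)
  \<comment> \<open>A vanishing form puts the column of \<open>D\<close> in the kernel of
    \<open>X\<close>, which is trivial.\<close>
  hence "D *v axis i 1 = 0" for i
    using psd_zero_form[OF X] inj by blast
  hence "D = 0"
    by (simp add: vec_eq_iff matrix_vector_mul_component inner_axis)
  thus ?thesis by (simp add: D_def)
qed

lemma loewner_mat1_form:
  fixes Q :: "real^'n^'n"
  assumes "loewner_le (mat 1) Q"
  shows "v \<bullet> v \<le> v \<bullet> (Q *v v)"
  using assms by (auto simp: loewner_le_def psd_def matrix_vector_mult_diff_rdistrib inner_diff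
      dest: spec[of _ v])

text \<open>
  Scale \<open>Q = c (1 - M)\<close> so that \<open>M\<close> has norm at most \<open>r < 1\<close>. The map \<open>N \<mapsto> (M + N\<^sup>2) / 2\<close> contracts
  the ball of radius \<open>r\<close>, and its fixed point satisfies \<open>(1 - N)\<^sup>2 = 1 - M\<close>.
\<close>

lemma psd_sqrt_exists:
  fixes Q :: "real^'n^'n"
  assumes sym: "symmetric_matrix Q" and ge: "loewner_le (mat 1) Q"
  shows "\<exists>X. psd X \<and> X ** X = Q"
proof -
  define QL where "QL = Blinfun ((*v) Q)"
  have QL: "blinfun_apply QL v = Q *v v" for v
    by (simp add: QL_def bounded_linear_Blinfun_apply)
  \<comment> \<open>From |Q v|^2 \<le> c |v|^2 and v . Q v \<ge> |v|^2 follows |M v|^2 \<le> (1 -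
    2/c + 1/c) |v|^2, which explains \<open>r\<close>. The added 1 gives c \<ge> 1.\<close>
  define c where "c = (norm QL)^2 + 1"
  have c1: "c \<ge> 1" by (simp add: c_def)
  define r where "r = sqrt (1 - 1 / c)"
  have r0: "0 \<le> r" and r1: "r < 1" and r2: "r^2 = 1 - 1 / c"
    using c1 by (auto simp: r_def)
  define M where "M = id_blinfun - (1 / c) *\<^sub>R QL"
  have M: "blinfun_apply M v = v - (1 / c) *\<^sub>R (Q *v v)" for v
    by (simp add: M_def blinfun.bilinear_simps QL)
  have "norm M \<le> r"
  proof (rule norm_blinfun_bound[OF r0])
    fix v
    have "norm (Q *v v) \<le> norm QL * norm v"
      using norm_blinfun[of QL v] QL by simp
    hence "(Q *v v) \<bullet> (Q *v v) \<le> (norm QL)^2 * (v \<bullet> v)"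
      by (metis dot_square_norm norm_ge_zero power_mono power_mult_distrib)
    also have "\<dots> \<le> c * (v \<bullet> v)" by (simp add: c_def algebra_simps)
    finally have q: "(Q *v v) \<bullet> (Q *v v) \<le> c * (v \<bullet> v)" .
    have "(norm (M v))^2 = v \<bullet> v - (2 / c) * (v \<bullet> (Q *v v)) + (1/c)^2 * ((Q *v v) \<bullet> (Q *v v))"
      unfolding M dot_square_norm[symmetric]
      by (simp add: inner_diff inner_commute power2_eq_square algebra_simps)
    also have "\<dots> \<le> v \<bullet> v - (2 / c) * (v \<bullet> v) + (1/c)^2 * (c * (v \<bullet> v))"
      using loewner_mat1_form[OF ge, of v] q c1
      by (intro add_mono diff_mono mult_left_mono) auto
    also have "\<dots> = (1 - 1 / c) * (v \<bullet> v)"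
      using c1 by (simp add: field_simps power2_eq_square)
    also have "\<dots> = (r * norm v)^2"
      by (simp add: power_mult_distrib r2 dot_square_norm)
    finally show "norm (M v) \<le> r * norm v"
      using r0 by (meson mult_nonneg_nonneg norm_ge_zero power2_le_imp_le)
  qed
  \<comment> \<open>Self-adjointness is a closed condition preserved by \<open>F\<close>; as a part
    of \<open>K\<close> it passes to the fixed point.\<close>
  define K where "K = {N :: (real^'n) \<Rightarrow>\<^sub>L (real^'n). norm N \<le> r \<and> (\<forall>a b. a \<bullet> blinfun_apply N b = blinfun_apply N a \<bullet> b)}"
  define F where "F = (\<lambda>N. (1/2) *\<^sub>R (M + (N o\<^sub>L N)))"
  have "closed K"
  proof -
    have "closed {N :: (real^'n) \<Rightarrow>\<^sub>L (real^'n). norm N \<le> r}"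
      by (intro closed_Collect_le continuous_intros)
    moreover have "closed {N :: (real^'n) \<Rightarrow>\<^sub>L (real^'n). \<forall>a b. a \<bullet> blinfun_apply N b = blinfun_apply N a \<bullet> b}"
      by (intro closed_Collect_all closed_Collect_eq continuous_intros)
    ultimately show ?thesis unfolding K_def by (simp add: Collect_conj_eq closed_Int)
  qed
  hence "complete K" by (simp add: complete_eq_closed)
  moreover have "K \<noteq> {}"
    unfolding K_def using r0 by (auto intro!: exI[of _ 0])
  moreover have "F ` K \<subseteq> K"
  proof safe
    fix N assume N: "N \<in> K"
    have nN: "norm N \<le> r" and sN: "\<And>a b. a \<bullet> N b = N a \<bullet> b" using N by (auto simp: K_def)
    have "norm (N o\<^sub>L N) \<le> norm N * norm N" by (rule norm_blinfun_compose)
    also have "\<dots> \<le> r * 1" using nN r1 by (intro mult_mono) (auto simp: r0)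
    finally have "norm (F N) \<le> r"
      unfolding F_def using norm_triangle_ineq[of M "N o\<^sub>L N"] \<open>norm M \<le> r\<close> by simp
    moreover have "a \<bullet> F N b = F N a \<bullet> b" for a b
      unfolding F_def
      by (simp add: blinfun.bilinear_simps inner_add inner_diff M sN symmetric_flip[OF sym])
    ultimately show "F N \<in> K" by (simp add: K_def)
  qed
  moreover have "\<And>N N'. N \<in> K \<and> N' \<in> K \<Longrightarrow> dist (F N) (F N') \<le> r * dist N N'"
  proof -
    fix N N' assume N: "N \<in> K \<and> N' \<in> K"
    \<comment> \<open>The difference of squares is split without commutativity. Each summand costs a
      factor \<open>r\<close>, and the 1/2 in \<open>F\<close> compensates for there being
      two.\<close>
    have eq: "F N - F N' = (1/2) *\<^sub>R ((N o\<^sub>L (N - N')) + ((N - N') o\<^sub>L N'))"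
      by (rule blinfun_eqI) (simp add: F_def blinfun.bilinear_simps algebra_simps)
    have "norm (N o\<^sub>L (N - N')) \<le> r * norm (N - N')"
      using N by (intro order_trans[OF norm_blinfun_compose] mult_right_mono) (auto simp: K_def)
    moreover have "norm ((N - N') o\<^sub>L N') \<le> norm (N - N') * r"
      using N by (intro order_trans[OF norm_blinfun_compose] mult_left_mono) (auto simp: K_def)
    ultimately show "dist (F N) (F N') \<le> r * dist N N'"
      using norm_triangle_ineq[of "N o\<^sub>L (N - N')" "(N - N') o\<^sub>L N'"]
      by (simp add: dist_norm eq mult.commute)
  qed
  ultimately obtain N where N: "N \<in> K" "F N = N"
    using Banach_fix[of K r F] r0 r1 by auto
  have nN: "norm N \<le> r" and sN: "\<And>a b. a \<bullet> N b = N a \<bullet> b" using N(1) by (auto simp: K_def)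
  define G where "G = (\<lambda>v. sqrt c *\<^sub>R (v - N v))"
  have "linear G"
    unfolding G_def by (intro linearI) (simp_all add: blinfun.bilinear_simps algebra_simps)
  define X where "X = matrix G"
  have X: "X *v v = G v" for v
    using \<open>linear G\<close> by (simp add: X_def matrix_works)
  have "G (G v) = Q *v v" for v
  proof -
    have "2 *\<^sub>R N v = M v + N (N v)"
      by (subst N(2)[symmetric]) (simp add: F_def blinfun.bilinear_simps)
    \<comment> \<open>The fixed point equation 2 N = M + N^2 is solved for N^2, so that (1 - N)^2 =
      1 - M = Q / c.\<close>
    hence "N (N v) = 2 *\<^sub>R N v - v + (1/c) *\<^sub>R (Q *v v)" by (simp add: M algebra_simps)
    hence "v - N v - N (v - N v) = (1/c) *\<^sub>R (Q *v v)"
      by (simp add: blinfun.bilinear_simps algebra_simps scaleR_2)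
    moreover have "G (G v) = c *\<^sub>R (v - N v - N (v - N v))"
      using c1 unfolding G_def
      by (simp add: blinfun.scaleR_right flip: scaleR_diff_right)
    ultimately show ?thesis using c1 by simp
  qed
  hence "X ** X = Q"
    by (simp add: matrix_eq X flip: matrix_vector_mul_assoc)
  moreover have "psd X"
    unfolding psd_def
  proof safe
    have "(transpose X *v a) \<bullet> b = (X *v a) \<bullet> b" for a b
    proof -
      have "(transpose X *v a) \<bullet> b = a \<bullet> (X *v b)"
        by (simp add: dot_lmul_matrix flip: vector_transpose_matrix)
      also have "\<dots> = (X *v a) \<bullet> b" by (simp add: X G_def sN inner_diff)
      finally show ?thesis .
    qed
    thus "symmetric_matrix X"
      unfolding symmetric_matrix_def by (metis matrix_eq vector_eq_rdot)
  next
    fix v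
    have "v \<bullet> N v \<le> norm v * norm (N v)" by (rule norm_cauchy_schwarz)
    also have "\<dots> \<le> norm v * (1 * norm v)"
      using nN r1 norm_blinfun[of N v]
      by (intro mult_left_mono order_trans[OF norm_blinfun] mult_right_mono) auto
    finally have "v \<bullet> N v \<le> v \<bullet> v" by (simp add: dot_square_norm power2_eq_square)
    thus "0 \<le> v \<bullet> (X *v v)" using c1 by (simp add: X G_def inner_diff)
  qed
  ultimately show ?thesis by blast
qed

text \<open>Every square root of \<open>Q\<close> is injective because Q \<ge> 1 is, so the
  uniqueness result applies and the description defining \<open>matrix_sqrt\<close> denotes.
  Injectivity also gives a left inverse, which for a square matrix is two-sided.\<close>

lemma matrix_sqrt_properties:
  fixes Q :: "real^'n^'n"
  assumes sym: "symmetric_matrix Q" and ge: "loewner_le (mat 1) Q"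
  shows "psd (matrix_sqrt Q)" "matrix_sqrt Q ** matrix_sqrt Q = Q"
    "matrix_inv (matrix_sqrt Q) ** matrix_sqrt Q = mat 1"
proof -
  have inj: "v = 0" if "X ** X = Q" "X *v v = 0" for X v
  proof -
    have "Q *v v = 0" using that by (metis matrix_vector_mul_assoc matrix_vector_mult_0_right)
    hence "v \<bullet> v \<le> 0" using loewner_mat1_form[OF ge, of v] by simp
    thus ?thesis by (metis inner_eq_zero_iff inner_ge_zero order_antisym)
  qed
  have "\<exists>!X. psd X \<and> X ** X = Q"
    using psd_sqrt_exists[OF assms] psd_sqrt_unique inj by (metis (full_types))
  from theI'[OF this] show *: "psd (matrix_sqrt Q)" "matrix_sqrt Q ** matrix_sqrt Q = Q"
    by (auto simp: matrix_sqrt_def)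
  have "\<exists>B. B ** matrix_sqrt Q = mat 1"
    using inj[OF *(2)] by (simp add: matrix_left_invertible_ker)
  thus "matrix_inv (matrix_sqrt Q) ** matrix_sqrt Q = mat 1"
    unfolding matrix_inv_def invertible_left_inverse[symmetric] invertible_def
    by (rule someI2_ex) blast
qed

section \<open>Weighted norms and jump gains\<close>

text \<open>The quadratic form is used instead of \<open>matrix_sqrt\<close> so that the square can
  be differentiated along the flow.\<close>

definition qnorm :: "real^'n^'n \<Rightarrow> real^'n \<Rightarrow> real" where
  "qnorm Q v = sqrt (v \<bullet> (Q *v v))"

text \<open>This identity links the gains, which are stated with square roots, to
  \<open>qnorm\<close>, and lets \<open>qnorm\<close> inherit the triangle inequality.\<close>

lemma norm_matrix_sqrt_mult:
  fixes Q :: "real^'n^'n"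
  assumes "symmetric_matrix Q" "loewner_le (mat 1) Q"
  shows "norm (matrix_sqrt Q *v v) = qnorm Q v"
proof -
  have s: "symmetric_matrix (matrix_sqrt Q)" "matrix_sqrt Q ** matrix_sqrt Q = Q"
    using matrix_sqrt_properties[OF assms] by (auto simp: psd_def)
  have "(matrix_sqrt Q *v v) \<bullet> (matrix_sqrt Q *v v) = v \<bullet> (Q *v v)"
    using symmetric_flip[OF s(1), of v "matrix_sqrt Q *v v"] s(2) by (simp add: matrix_vector_mul_assoc)
  thus ?thesis by (simp add: qnorm_def norm_eq_sqrt_inner)
qed

lemma norm_mult_le_spectral: "norm (M *v v) \<le> spectral_norm M * norm v" for M :: "real^'n^'m"
  unfolding spectral_norm_def by (intro onorm matrix_vector_mul_bounded_linear)

lemma spectral_norm_nonneg: "0 \<le> spectral_norm M"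
  unfolding spectral_norm_def by (intro onorm_pos_le matrix_vector_mul_bounded_linear)

lemma spectral_norm_le_jump_gain:
  assumes "finite I" "finite J" "i \<in> I" "j \<in> J" "i' \<in> I"
  shows "spectral_norm (matrix_sqrt (Qout i') ** Rb i j i' ** matrix_inv (matrix_sqrt (Qin i)))
    \<le> jump_gain I J Qout Qin Rb"
proof -
  let ?f = "\<lambda>i j i'. spectral_norm (matrix_sqrt (Qout i') ** Rb i j i' ** matrix_inv (matrix_sqrt (Qin i)))"
  have "{?f i j i' | i j i'. i \<in> I \<and> j \<in> J \<and> i' \<in> I} = (\<lambda>(i, j, i'). ?f i j i') ` (I \<times> J \<times> I)"
    by force
  hence "finite {?f i j i' | i j i'. i \<in> I \<and> j \<in> J \<and> i' \<in> I}" using assms by simp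
  thus ?thesis unfolding jump_gain_def using assms by (intro Max_ge) auto
qed

lemma jump_gain_nonneg:
  assumes "finite I" "finite J" "i \<in> I" "j \<in> J"
  shows "0 \<le> jump_gain I J Qout Qin Rb"
  using spectral_norm_le_jump_gain[OF assms assms(3)] spectral_norm_nonneg order_trans by blast

text \<open>Inserting the inverse square root of \<open>Qin i\<close> times the square root in front
  of \<open>v\<close> exposes the matrix whose spectral norm enters the gain.\<close>

lemma jump_gain_bound:
  fixes Rb :: "'i \<Rightarrow> 'j \<Rightarrow> 'i \<Rightarrow> real^'n^'m"
  assumes "finite I" "finite J" "i \<in> I" "j \<in> J" "i' \<in> I"
    and "symmetric_matrix (Qin i)" "loewner_le (mat 1) (Qin i)"
    and "symmetric_matrix (Qout i')" "loewner_le (mat 1) (Qout i')"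
  shows "qnorm (Qout i') (Rb i j i' *v v) \<le> jump_gain I J Qout Qin Rb * qnorm (Qin i) v"
proof -
  let ?M = "matrix_sqrt (Qout i') ** Rb i j i' ** matrix_inv (matrix_sqrt (Qin i))"
  have "qnorm (Qout i') (Rb i j i' *v v) = norm (matrix_sqrt (Qout i') *v (Rb i j i' *v v))"
    using assms by (simp add: norm_matrix_sqrt_mult)
  also have "\<dots> = norm (?M *v (matrix_sqrt (Qin i) *v v))"
    using matrix_sqrt_properties(3)[OF assms(6,7)]
    by (metis matrix_mul_assoc matrix_mul_rid matrix_vector_mul_assoc)
  also have "\<dots> \<le> spectral_norm ?M * norm (matrix_sqrt (Qin i) *v v)"
    by (rule norm_mult_le_spectral)
  also have "\<dots> \<le> jump_gain I J Qout Qin Rb * norm (matrix_sqrt (Qin i) *v v)"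
    by (intro mult_right_mono spectral_norm_le_jump_gain assms norm_ge_zero)
  finally show ?thesis by (simp only: norm_matrix_sqrt_mult[OF assms(6,7)])
qed

section \<open>Scalar comparison along the flow\<close>

text \<open>
  The bound on \<open>u\<close> holds because \<open>u + K \<epsilon> v\<close> is nonincreasing. This bounds the input of \<open>u\<close> into the
  equation of \<open>v\<close>, so that \<open>v - m\<close> decays at rate \<open>\<kappa> / \<epsilon>\<close> for a constant \<open>m = O(\<epsilon>\<^sup>2)\<close>.
\<close>

lemma flow_bounds:
  fixes u v :: "real \<Rightarrow> real"
  assumes l: "\<kappa> > 0" and e: "\<epsilon> > 0" and b: "b \<ge> 0"
    and K: "K = 2 * b^2 / \<kappa>^2 + 1" and Ke: "K * \<epsilon> \<le> 1" and be: "b * \<epsilon> \<le> \<kappa> / 4"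
    and nonneg: "\<And>t. u t \<ge> 0" "\<And>t. v t \<ge> 0"
    and du: "\<And>t. t \<in> {p..<q} \<Longrightarrow> (u has_real_derivative u' t) (at t within {p..<q})"
    and dv: "\<And>t. t \<in> {p..<q} \<Longrightarrow> (v has_real_derivative v' t) (at t within {p..<q})"
    and u': "\<And>t. t \<in> {p..<q} \<Longrightarrow> u' t \<le> - 2 * \<kappa> * u t + 2 * b * (sqrt (u t) * sqrt (v t))"
    and v': "\<And>t. t \<in> {p..<q} \<Longrightarrow>
        \<epsilon> * v' t \<le> - 2 * \<kappa> * v t + 2 * \<epsilon> * b * (sqrt (u t) * sqrt (v t)) + 2 * \<epsilon> * b * v t"
    and t: "t \<in> {p..<q}"
  shows "u t \<le> u p + K * \<epsilon> * v p" and "v t \<le> (1 + K * \<epsilon>) * v p + K * \<epsilon> * u p"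
proof -
  have open_deriv: "(f has_real_derivative f') (at s)"
    if "p < s" "s < q" "(f has_real_derivative f') (at s within {p..<q})" for f f' s
  proof -
    have "s \<in> interior {p..<q}" using that by simp
    thus ?thesis using that(3) by (metis at_within_interior)
  qed
  \<comment> \<open>The sign of the derivative matters only on the open interval; at
    \<open>p\<close> the one-sided derivative supplies continuity.\<close>
  have dec: "f s \<le> f p"
    if sq: "s \<in> {p..<q}" and D: "\<And>t. t \<in> {p..<q} \<Longrightarrow> (f has_real_derivative f' t) (at t within {p..<q})"
      "\<And>t. t \<in> {p..<q} \<Longrightarrow> f' t \<le> 0" for f f' :: "real \<Rightarrow> real" and s
  proof (rule DERIV_nonpos_imp_decreasing_open[where f = f and a = p and b = s])
    show "p \<le> s" using sq by auto
    show "\<exists>y. DERIV f x :> y \<and> y \<le> 0" if x: "p < x" "x < s" for x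
    proof -
      have "x \<in> {p..<q}" "x < q" using x sq by auto
      thus ?thesis by (intro exI[of _ "f' x"] conjI open_deriv[OF x(1)] D)
    qed
    have "continuous_on {p..<q} f" using D(1) by (rule DERIV_continuous_on)
    thus "continuous_on {p..s} f" by (rule continuous_on_subset) (use sq in auto)
  qed
  have K1: "K \<ge> 1" using K by simp
  have KL: "K * \<kappa>^2 = 2 * b^2 + \<kappa>^2" using l by (simp add: K field_simps)
  have ub: "u s \<le> u p + K * \<epsilon> * v p" if s: "s \<in> {p..<q}" for s
  proof -
    have "u s + K * \<epsilon> * v s \<le> u p + K * \<epsilon> * v p"
    proof (rule dec[OF s, of "\<lambda>s. u s + K * \<epsilon> * v s" "\<lambda>s. u' s + K * \<epsilon> * v' s"])
      fix s assume s: "s \<in> {p..<q}"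
      show "((\<lambda>s. u s + K * \<epsilon> * v s) has_real_derivative u' s + K * \<epsilon> * v' s) (at s within {p..<q})"
        using du[OF s] dv[OF s] by (auto intro!: derivative_eq_intros)
      \<comment> \<open>In the square roots the bound on the derivative becomes a quadratic form,
        which is shown to be nonpositive.\<close>
      define x y where "x = sqrt (u s)" and "y = sqrt (v s)"
      have xy: "u s = x^2" "v s = y^2" "x \<ge> 0" "y \<ge> 0" using nonneg by (auto simp: x_def y_def)
      have "K * (\<epsilon> * v' s) \<le> K * (- 2 * \<kappa> * y^2 + 2 * \<epsilon> * b * (x * y) + 2 * \<epsilon> * b * y^2)"
        using v'[OF s] K1 by (intro mult_left_mono) (simp_all flip: x_def y_def add: xy)
      \<comment> \<open>\<open>Ke\<close> makes the coupling from the fast equation at most as large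
        as the one from the slow equation; \<open>be\<close> then spends a quarter of the fast
        dissipation on the term with y^2.\<close>
      moreover have "K * (2 * \<epsilon> * b * (x * y)) \<le> 2 * b * (x * y)"
        using mult_right_mono[OF Ke, of "2 * b * (x * y)"] b xy by (simp add: algebra_simps)
      moreover have "K * (2 * \<epsilon> * b * y^2) \<le> K * (\<kappa> / 2 * y^2)"
        using be K1 mult_right_mono[OF be, of "2 * y^2"] by (intro mult_left_mono) (auto simp: algebra_simps)
      moreover have "u' s \<le> - 2 * \<kappa> * x^2 + 2 * b * (x * y)"
        using u'[OF s] by (simp flip: x_def y_def add: xy)
      ultimately have "u' s + K * \<epsilon> * v' s \<le> - 2 * \<kappa> * x^2 + 4 * b * (x * y) - 3/2 * K * \<kappa> * y^2"
        by (simp add: algebra_simps)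
      \<comment> \<open>Multiplying by \<kappa> > 0 allows completing the square without fractions.
        \<open>K\<close> is chosen such that \<open>KL\<close> covers the y^2 terms.\<close>
      moreover have "\<kappa> * (- 2 * \<kappa> * x^2 + 4 * b * (x * y) - 3/2 * K * \<kappa> * y^2) \<le> 0"
      proof -
        have "\<kappa> * (- 2 * \<kappa> * x^2 + 4 * b * (x * y) - 3/2 * K * \<kappa> * y^2)
            = - 2 * (\<kappa> * x)^2 + 4 * (\<kappa> * x) * (b * y) - 3/2 * (K * \<kappa>^2) * y^2"
          by (simp add: power2_eq_square algebra_simps)
        also have "\<dots> = - 2 * (\<kappa> * x - b * y)^2 - (b * y)^2 - 3/2 * (\<kappa> * y)^2"
          unfolding KL by (simp add: power2_eq_square algebra_simps)
        also have "\<dots> \<le> 0" 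
          using zero_le_power2[of "\<kappa> * x - b * y"] zero_le_power2[of "b * y"] zero_le_power2[of "\<kappa> * y"]
          by linarith
        finally show ?thesis .
      qed
      hence "- 2 * \<kappa> * x^2 + 4 * b * (x * y) - 3/2 * K * \<kappa> * y^2 \<le> 0"
        using l by (simp only: mult_le_0_iff) linarith
      ultimately show "u' s + K * \<epsilon> * v' s \<le> 0" by linarith
    qed
    moreover have "0 \<le> K * \<epsilon> * v s" using K1 e nonneg by simp
    ultimately show ?thesis by linarith
  qed
  thus "u t \<le> u p + K * \<epsilon> * v p" using t .
  \<comment> \<open>\<open>\<kappa> * m\<close> is what Young's inequality leaves of the coupling
    term once \<open>u\<close> is replaced by its bound; hence \<epsilon> v' \<le> -\<kappa> (v -
    m), and exp (c (s - p)) is the integrating factor.\<close>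
  define m where "m = 2 * b^2 / \<kappa>^2 * \<epsilon>^2 * (u p + K * \<epsilon> * v p)"
  define c where "c = \<kappa> / \<epsilon>"
  have m0: "m \<ge> 0" using K1 e nonneg by (simp add: m_def)
  have "exp (c * (t - p)) * (v t - m) \<le> exp (c * (p - p)) * (v p - m)"
  proof (rule dec[OF t, of "\<lambda>s. exp (c * (s - p)) * (v s - m)" "\<lambda>s. exp (c * (s - p)) * (c * (v s - m) + v' s)"])
    fix s assume s: "s \<in> {p..<q}"
    show "((\<lambda>s. exp (c * (s - p)) * (v s - m)) has_real_derivative
        exp (c * (s - p)) * (c * (v s - m) + v' s)) (at s within {p..<q})"
      using dv[OF s] by (auto intro!: derivative_eq_intros simp: algebra_simps)
    define x y where "x = sqrt (u s)" and "y = sqrt (v s)"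
    have xy: "u s = x^2" "v s = y^2" "x \<ge> 0" "y \<ge> 0" using nonneg by (auto simp: x_def y_def)
    have vs: "\<epsilon> * v' s \<le> - 2 * \<kappa> * y^2 + 2 * \<epsilon> * b * (x * y) + 2 * \<epsilon> * b * y^2"
      using v'[OF s] by (simp flip: x_def y_def add: xy)
    have 1: "2 * \<epsilon> * b * y^2 \<le> \<kappa> / 2 * y^2"
      using mult_right_mono[OF be, of "2 * y^2"] by (simp add: algebra_simps)
    have "2 * \<epsilon> * b * (x * y) \<le> \<kappa> / 2 * y^2 + 2 * b^2 / \<kappa> * \<epsilon>^2 * x^2"
    proof -
      have "0 \<le> (\<kappa> * y - 2 * \<epsilon> * b * x)^2 / (2 * \<kappa>)" using l by simp
      also have "\<dots> = \<kappa> / 2 * y^2 + 2 * b^2 / \<kappa> * \<epsilon>^2 * x^2 - 2 * \<epsilon> * b * (x * y)"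
        using l by (simp add: field_simps power2_eq_square)
      finally show ?thesis by simp
    qed
    also have "2 * b^2 / \<kappa> * \<epsilon>^2 * x^2 \<le> 2 * b^2 / \<kappa> * \<epsilon>^2 * (u p + K * \<epsilon> * v p)"
      using ub[OF s] l by (intro mult_left_mono) (auto simp: xy)
    also have "\<dots> = \<kappa> * m" using l by (simp add: m_def power2_eq_square)
    finally have "\<epsilon> * v' s \<le> - \<kappa> * (v s - m)"
      using vs 1 by (simp add: xy algebra_simps)
    hence "\<epsilon> * (c * (v s - m) + v' s) \<le> 0"
      using e by (simp add: c_def algebra_simps)
    hence "c * (v s - m) + v' s \<le> 0" using e by (simp add: mult_le_0_iff)
    thus "exp (c * (s - p)) * (c * (v s - m) + v' s) \<le> 0"
      by (simp add: mult_le_0_iff)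
  qed
  hence d: "exp (c * (t - p)) * (v t - m) \<le> v p - m" by simp
  \<comment> \<open>Only monotonicity is kept from the exponential decay, since \<open>t\<close> may
    be arbitrarily close to \<open>p\<close>.\<close>
  have vt: "v t \<le> v p + m"
  proof (cases "v t \<le> m")
    case False
    have "1 \<le> exp (c * (t - p))" using t l e by (simp add: c_def)
    hence "1 * (v t - m) \<le> exp (c * (t - p)) * (v t - m)"
      using False by (intro mult_right_mono) auto
    hence "v t - m \<le> v p - m" using d by simp
    thus ?thesis using m0 by linarith
  qed (use nonneg[of p] m0 in \<open>auto intro: add_increasing\<close>)
  \<comment> \<open>With \<epsilon> \<le> 1 the factor \<epsilon>^2 in \<open>m\<close> may be
    weakened to \<epsilon>.\<close>
  have "\<epsilon> \<le> 1" using Ke e mult_right_mono[OF K1, of \<epsilon>] by linarith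
  have Kp: "0 \<le> K * \<epsilon>" using K1 e by simp
  have "m \<le> K * \<epsilon> * (u p + K * \<epsilon> * v p)"
  proof -
    have "2 * b^2 / \<kappa>^2 * \<epsilon>^2 \<le> K * \<epsilon>"
      using e \<open>\<epsilon> \<le> 1\<close> unfolding K by (intro mult_mono) (simp_all add: power2_eq_square mult_left_le)
    thus ?thesis unfolding m_def using nonneg Kp by (intro mult_right_mono) auto
  qed
  also have "\<dots> \<le> K * \<epsilon> * (u p + 1 * v p)"
    using Ke Kp nonneg by (intro mult_left_mono add_left_mono mult_right_mono) auto
  finally show "v t \<le> (1 + K * \<epsilon>) * v p + K * \<epsilon> * u p"
    using vt by (simp add: algebra_simps)
qed

section \<open>Choice of the weight and growth of the weighted sum\<close>

text \<open>The row vector (1, \<beta>) must be strictly decreased by the matrix with rows (a, b)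
  and (c, d). Its columns demand \<beta> c < 1 - a and \<beta> > b / (1 - d). The small-gain
  condition says that \<beta> = b / (1 - d) satisfies the first strictly, so a slightly larger value
  satisfies both.\<close>

lemma small_gain_weights:
  fixes a b c d :: real
  assumes "0 \<le> b" "0 \<le> c" "a < 1" "d < 1" "0 \<le> a" "0 \<le> d" "b * c / ((1 - a) * (1 - d)) < 1"
  shows "\<exists>\<beta>>0. \<exists>\<theta>. 0 \<le> \<theta> \<and> \<theta> < 1 \<and> a + \<beta> * c \<le> \<theta> \<and> b + \<beta> * d \<le> \<theta> * \<beta>"
proof -
  \<comment> \<open>The enlargement consumes only part of the slack in \<beta> c < 1 - a; the
    denominator c + 1 also covers c = 0.\<close>
  define \<delta> where "\<delta> = (1 - a - b * c / (1 - d)) / (c + 1)"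
  define \<beta> where "\<beta> = b / (1 - d) + \<delta>"
  have "b * c / (1 - d) < 1 - a"
  proof -
    have "b * c < (1 - a) * (1 - d)"
      using assms by (subst (asm) pos_divide_less_eq) auto
    thus ?thesis using assms by (simp add: pos_divide_less_eq)
  qed
  hence \<delta>: "\<delta> > 0" using assms by (simp add: \<delta>_def)
  have \<beta>: "\<beta> > 0" using \<delta> assms by (simp add: \<beta>_def add_nonneg_pos)
  have "c * \<delta> < 1 - a - b * c / (1 - d)"
  proof -
    have "(c + 1) * \<delta> = 1 - a - b * c / (1 - d)" using assms by (simp add: \<delta>_def)
    thus ?thesis using \<delta> by (simp add: algebra_simps)
  qed
  hence 1: "a + \<beta> * c < 1" by (simp add: \<beta>_def algebra_simps)
  have "\<beta> * (1 - d) = b + \<delta> * (1 - d)" using assms by (simp add: \<beta>_def distrib_right)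
  moreover have "0 < \<delta> * (1 - d)" using \<delta> assms by simp
  ultimately have "b < \<beta> * (1 - d)" by simp
  hence 2: "b + \<beta> * d < \<beta>" by (simp add: algebra_simps)
  define \<theta> where "\<theta> = max (a + \<beta> * c) ((b + \<beta> * d) / \<beta>)"
  have "0 \<le> \<theta>" unfolding \<theta>_def using \<beta> assms by (intro max.coboundedI1) simp
  moreover have "\<theta> < 1" unfolding \<theta>_def using 1 2 \<beta> by simp
  moreover have "a + \<beta> * c \<le> \<theta>" by (simp add: \<theta>_def)
  moreover have "b + \<beta> * d \<le> \<theta> * \<beta>"
  proof -
    have "(b + \<beta> * d) / \<beta> \<le> \<theta>" by (simp add: \<theta>_def)
    thus ?thesis using \<beta> by (simp add: pos_divide_le_eq)
  qed
  ultimately show ?thesis using \<beta> by blast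
qed

text \<open>This passes from squared norms, where the perturbation is h^2, to norms, where it is h.
  With h^2 = K \<epsilon> it is the source of the factor 1 + O(sqrt \<epsilon>).\<close>

lemma weighted_growth:
  fixes u0 v0 u v h \<beta> :: real
  assumes nn: "u0 \<ge> 0" "v0 \<ge> 0" "h \<ge> 0" "\<beta> > 0" "u \<ge> 0" "v \<ge> 0"
    and u: "u\<^sup>2 \<le> u0\<^sup>2 + h\<^sup>2 * v0\<^sup>2" and v: "v\<^sup>2 \<le> (1 + h\<^sup>2) * v0\<^sup>2 + h\<^sup>2 * u0\<^sup>2"
  shows "u + \<beta> * v \<le> (1 + h * (\<beta> + 1 + 1 / \<beta>)) * (u0 + \<beta> * v0)"
proof -
  have "u\<^sup>2 \<le> (u0 + h * v0)\<^sup>2" using u nn by (simp add: power2_sum power_mult_distrib add_increasing2)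
  hence 1: "u \<le> u0 + h * v0" using nn by (meson add_nonneg_nonneg mult_nonneg_nonneg power2_le_imp_le)
  have "(v0 + h * v0 + h * u0)\<^sup>2 = (1 + h\<^sup>2) * v0\<^sup>2 + h\<^sup>2 * u0\<^sup>2 + 2 * h * v0\<^sup>2 + 2 * h * v0 * u0 + 2 * h * h * v0 * u0"
    by (simp add: power2_eq_square algebra_simps)
  moreover have "0 \<le> 2 * h * v0\<^sup>2 + 2 * h * v0 * u0 + 2 * h * h * v0 * u0" using nn by simp
  ultimately have "v\<^sup>2 \<le> (v0 + h * v0 + h * u0)\<^sup>2" using v by linarith
  hence "v \<le> v0 + h * v0 + h * u0"
    using nn by (meson add_nonneg_nonneg mult_nonneg_nonneg power2_le_imp_le)
  hence "u + \<beta> * v \<le> u0 + h * v0 + \<beta> * (v0 + h * v0 + h * u0)"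
    using 1 nn by (intro add_mono mult_left_mono) auto
  \<comment> \<open>These nonnegative terms are exactly those missing for the sum to factor.\<close>
  also have "\<dots> \<le> \<dots> + (h * \<beta>\<^sup>2 * v0 + h * u0 + h * u0 / \<beta>)" using nn by simp
  also have "\<dots> = (1 + h * (\<beta> + 1 + 1 / \<beta>)) * (u0 + \<beta> * v0)"
    using nn by (simp add: field_simps power2_eq_square)
  finally show ?thesis .
qed

section \<open>Block vectors and comparison of norms\<close>

lemma sum_UNIV_sum_type:
  fixes f :: "'a::finite + 'b::finite \<Rightarrow> real"
  shows "(\<Sum>k\<in>UNIV. f k) = (\<Sum>a\<in>UNIV. f (Inl a)) + (\<Sum>b\<in>UNIV. f (Inr b))"
  using sum.Plus[of "UNIV :: 'a set" "UNIV :: 'b set" f] by simp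

lemma matrix_vector_mult_join:
  "M *v join u v = join (block11 M *v u + block12 M *v v) (block21 M *v u + block22 M *v v)"
  by (auto simp: vec_eq_iff matrix_vector_mult_def join_def block11_def block12_def block21_def
      block22_def sum_UNIV_sum_type split: sum.split)

lemma join_eq_iff: "join a b = join c d \<longleftrightarrow> a = c \<and> b = d"
  by (auto simp: join_def vec_eq_iff split: sum.splits)

lemma norm_join: "norm (join u v) = sqrt ((norm u)\<^sup>2 + (norm v)\<^sup>2)"
proof -
  have "join u v \<bullet> join u v = u \<bullet> u + v \<bullet> v"
    by (simp add: inner_vec_def join_def sum_UNIV_sum_type)
  thus ?thesis by (simp add: norm_eq_sqrt_inner)
qed

lemma qnorm_square:
  assumes "loewner_le (mat 1) Q"
  shows "(qnorm Q v)\<^sup>2 = v \<bullet> (Q *v v)"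
proof -
  have "0 \<le> v \<bullet> (Q *v v)" using loewner_mat1_form[OF assms, of v] inner_ge_zero order_trans by blast
  thus ?thesis by (simp add: qnorm_def)
qed

lemma norm_le_qnorm:
  assumes "loewner_le (mat 1) Q"
  shows "norm v \<le> qnorm Q v"
  using loewner_mat1_form[OF assms, of v] by (simp add: qnorm_def norm_eq_sqrt_inner)

lemma qnorm_nonneg: "loewner_le (mat 1) Q \<Longrightarrow> 0 \<le> qnorm Q v"
  using norm_le_qnorm norm_ge_zero order_trans by blast

lemma qnorm_triangle:
  assumes "symmetric_matrix Q" "loewner_le (mat 1) Q"
  shows "qnorm Q (u + v) \<le> qnorm Q u + qnorm Q v"
  by (simp add: matrix_vector_right_distrib norm_triangle_ineq flip: norm_matrix_sqrt_mult[OF assms])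

lemma qnorm_le_norm: "qnorm Q v \<le> sqrt (spectral_norm Q) * norm v"
proof -
  have "v \<bullet> (Q *v v) \<le> norm v * (spectral_norm Q * norm v)"
    by (intro order_trans[OF norm_cauchy_schwarz] mult_left_mono norm_mult_le_spectral) simp
  also have "\<dots> = spectral_norm Q * (norm v)\<^sup>2" by (simp add: power2_eq_square)
  finally have "sqrt (v \<bullet> (Q *v v)) \<le> sqrt (spectral_norm Q * (norm v)\<^sup>2)"
    by (rule real_sqrt_le_mono)
  thus ?thesis by (simp add: qnorm_def real_sqrt_mult)
qed

lemma tendsto_qnorm:
  assumes "(z \<longlongrightarrow> l) F"
  shows "((\<lambda>t. qnorm Q (z t)) \<longlongrightarrow> qnorm Q l) F"
  unfolding qnorm_def
  by (intro tendsto_intros assms bounded_linear.tendsto[OF matrix_vector_mul_bounded_linear])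

section \<open>Lyapunov estimates within one mode\<close>

lemma quadratic_form_derivative:
  fixes z :: "real \<Rightarrow> real^'n"
  assumes "symmetric_matrix Q" "(z has_vector_derivative z') (at t within S)"
  shows "((\<lambda>t. z t \<bullet> (Q *v z t)) has_real_derivative 2 * (z t \<bullet> (Q *v z'))) (at t within S)"
proof -
  have "((\<lambda>t. Q *v z t) has_vector_derivative Q *v z') (at t within S)"
    by (rule bounded_linear.has_vector_derivative[OF matrix_vector_mul_bounded_linear assms(2)])
  from bounded_bilinear.has_vector_derivative[OF bounded_bilinear_inner assms(2) this]
  show ?thesis
    using symmetric_flip[OF assms(1), of "z t" z']
    by (simp add: has_real_derivative_iff_has_vector_derivative inner_commute)
qed

text \<open>By symmetry of \<open>Q\<close> the two summands of the Lyapunov matrix have the same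
  form at \<open>z\<close>, which cancels the factor 2.\<close>

lemma lyapunov_form:
  assumes "symmetric_matrix Q" "loewner_le (transpose A ** Q + Q ** A) ((- 2 * \<kappa>) *\<^sub>R Q)"
  shows "z \<bullet> (Q *v (A *v z)) \<le> - \<kappa> * (z \<bullet> (Q *v z))"
proof -
  have "0 \<le> z \<bullet> (((- 2 * \<kappa>) *\<^sub>R Q - (transpose A ** Q + Q ** A)) *v z)"
    using assms(2) by (simp add: loewner_le_def psd_def)
  moreover have "z \<bullet> (transpose A *v (Q *v z)) = z \<bullet> (Q *v (A *v z))"
    using symmetric_flip[OF assms(1), of "A *v z" z] symmetric_flip[OF assms(1), of z "A *v z"]
    by (metis dot_lmul_matrix inner_commute transpose_matrix_vector)
  ultimately show ?thesis
    by (simp only: matrix_vector_mult_diff_rdistrib matrix_vector_mult_add_rdistrib inner_diff_right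
        inner_add_right inner_scaleR_right scaleR_matrix_vector_assoc[symmetric]
        matrix_vector_mul_assoc[symmetric])
qed

text \<open>Cauchy-Schwarz gives a bound in Euclidean norms, and these lie below the weighted norms
  because the weights are at least the identity.\<close>

lemma cross_term_bound:
  assumes "loewner_le (mat 1) P" "loewner_le (mat 1) P'" "spectral_norm (Q ** B) \<le> b"
  shows "x \<bullet> (Q *v (B *v y)) \<le> b * (qnorm P x * qnorm P' y)"
proof -
  have b: "0 \<le> b" using assms(3) spectral_norm_nonneg order_trans by blast
  have "x \<bullet> (Q *v (B *v y)) \<le> norm x * norm ((Q ** B) *v y)"
    by (simp add: norm_cauchy_schwarz matrix_vector_mul_assoc)
  also have "\<dots> \<le> norm x * (b * norm y)"
    by (intro mult_left_mono order_trans[OF norm_mult_le_spectral] mult_right_mono assms) auto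
  also have "\<dots> \<le> qnorm P x * (b * qnorm P' y)"
    using b assms by (intro mult_mono norm_le_qnorm mult_nonneg_nonneg qnorm_nonneg) auto
  finally show ?thesis by (simp add: mult_ac)
qed

text \<open>The squared weighted norms obey the inequalities of \<open>flow_bounds\<close>, and
  \<open>weighted_growth\<close> returns to the norms. As \<open>\<kappa>\<close> and
  \<open>b\<close> merely bound the data of the mode, one choice can serve all modes; the growth
  factor does not involve the length of the interval.\<close>

lemma mode_flow_bound:
  fixes A :: "real^('x::finite + 'z::finite)^('x + 'z)"
  assumes Qs: "symmetric_matrix Qs" "loewner_le (mat 1) Qs"
    and Qf: "symmetric_matrix Qf" "loewner_le (mat 1) Qf"
    and slow: "loewner_le (transpose (A0_mat A) ** Qs + Qs ** A0_mat A) ((- 2 * \<kappa>s) *\<^sub>R Qs)"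
    and fast: "loewner_le (transpose (block22 A) ** Qf + Qf ** block22 A) ((- 2 * \<kappa>f) *\<^sub>R Qf)"
    and \<kappa>: "0 < \<kappa>" "\<kappa> \<le> \<kappa>s" "\<kappa> \<le> \<kappa>f"
    and b: "spectral_norm (Qs ** B1_mat A) \<le> b" "spectral_norm (Qf ** B2_mat A) \<le> b"
      "spectral_norm (Qf ** B3_mat A) \<le> b"
    and e: "\<epsilon> > 0" and K: "K = 2 * b\<^sup>2 / \<kappa>\<^sup>2 + 1" and Ke: "K * \<epsilon> \<le> 1" and be: "b * \<epsilon> \<le> \<kappa> / 4"
    and \<beta>: "\<beta> > 0"
    and flow: "\<forall>t \<in> {p..<q}. \<exists>x' y'.
        (x has_vector_derivative x') (at t within {p..<q}) \<and>
        (y has_vector_derivative y') (at t within {p..<q}) \<and>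
        x' = A0_mat A *v x t + B1_mat A *v y t \<and>
        \<epsilon> *\<^sub>R y' = (\<epsilon> *\<^sub>R B2_mat A) *v x t + (block22 A + \<epsilon> *\<^sub>R B3_mat A) *v y t"
    and t: "t \<in> {p..<q}"
  shows "qnorm Qs (x t) + \<beta> * qnorm Qf (y t)
    \<le> (1 + sqrt (K * \<epsilon>) * (\<beta> + 1 + 1 / \<beta>)) * (qnorm Qs (x p) + \<beta> * qnorm Qf (y p))"
proof -
  define u where "u t = x t \<bullet> (Qs *v x t)" for t
  define v where "v t = y t \<bullet> (Qf *v y t)" for t
  have uq: "u t = (qnorm Qs (x t))\<^sup>2" and vq: "v t = (qnorm Qf (y t))\<^sup>2" for t
    using Qs Qf by (simp_all add: u_def v_def qnorm_square)
  have su: "sqrt (u t) = qnorm Qs (x t)" and sv: "sqrt (v t) = qnorm Qf (y t)" for t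
    by (simp_all add: qnorm_def u_def v_def)
  have uv0: "u t \<ge> 0" "v t \<ge> 0" for t by (simp_all add: uq vq)
  have b0: "0 \<le> b" using b(1) spectral_norm_nonneg order_trans by blast
  \<comment> \<open>The slow derivative is explicit; the fast one is given only through its multiple
    by \<epsilon>, so a function \<open>y'\<close> is chosen.\<close>
  have "\<forall>t \<in> {p..<q}. \<exists>y'. (x has_vector_derivative (A0_mat A *v x t + B1_mat A *v y t)) (at t within {p..<q}) \<and>
        (y has_vector_derivative y') (at t within {p..<q}) \<and>
        \<epsilon> *\<^sub>R y' = (\<epsilon> *\<^sub>R B2_mat A) *v x t + (block22 A + \<epsilon> *\<^sub>R B3_mat A) *v y t"
    using flow by blast
  then obtain y' where
    dx: "\<And>t. t \<in> {p..<q} \<Longrightarrow> (x has_vector_derivative (A0_mat A *v x t + B1_mat A *v y t)) (at t within {p..<q})"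
    and dy: "\<And>t. t \<in> {p..<q} \<Longrightarrow> (y has_vector_derivative y' t) (at t within {p..<q})"
    and y': "\<And>t. t \<in> {p..<q} \<Longrightarrow>
        \<epsilon> *\<^sub>R y' t = (\<epsilon> *\<^sub>R B2_mat A) *v x t + (block22 A + \<epsilon> *\<^sub>R B3_mat A) *v y t"
    by metis
  define u' where "u' t = 2 * (x t \<bullet> (Qs *v (A0_mat A *v x t + B1_mat A *v y t)))" for t
  define v' where "v' t = 2 * (y t \<bullet> (Qf *v y' t))" for t
  have u'b: "u' t \<le> - 2 * \<kappa> * u t + 2 * b * (sqrt (u t) * sqrt (v t))" for t
  proof -
    have "x t \<bullet> (Qs *v (A0_mat A *v x t)) \<le> - \<kappa>s * u t"
      unfolding u_def by (rule lyapunov_form[OF Qs(1) slow])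
    moreover have "\<kappa> * u t \<le> \<kappa>s * u t" using \<kappa> uv0 by (intro mult_right_mono)
    moreover have "x t \<bullet> (Qs *v (B1_mat A *v y t)) \<le> b * (sqrt (u t) * sqrt (v t))"
      unfolding su sv by (intro cross_term_bound b Qs Qf)
    ultimately show ?thesis
      by (simp add: u'_def matrix_vector_right_distrib inner_add_right)
  qed
  have v'b: "\<epsilon> * v' t \<le> - 2 * \<kappa> * v t + 2 * \<epsilon> * b * (sqrt (u t) * sqrt (v t)) + 2 * \<epsilon> * b * v t"
    if "t \<in> {p..<q}" for t
  proof -
    have "\<epsilon> * v' t = 2 * (y t \<bullet> (Qf *v (\<epsilon> *\<^sub>R y' t)))"
      by (simp add: v'_def matrix_vector_mult_scaleR)
    also have "\<dots> = 2 * \<epsilon> * (y t \<bullet> (Qf *v (B2_mat A *v x t))) + 2 * (y t \<bullet> (Qf *v (block22 A *v y t)))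
        + 2 * \<epsilon> * (y t \<bullet> (Qf *v (B3_mat A *v y t)))"
      unfolding y'[OF that]
      by (simp add: matrix_vector_right_distrib matrix_vector_mult_add_rdistrib inner_add_right
          matrix_vector_mult_scaleR algebra_simps flip: scaleR_matrix_vector_assoc)
    also have "\<dots> \<le> 2 * \<epsilon> * (b * (sqrt (v t) * sqrt (u t))) + 2 * (- \<kappa>f * v t)
        + 2 * \<epsilon> * (b * (sqrt (v t) * sqrt (v t)))"
      unfolding su sv using e
      by (intro add_mono mult_left_mono cross_term_bound b Qs Qf)
        (use lyapunov_form[OF Qf(1) fast, of "y t"] in \<open>auto simp: v_def\<close>)
    also have "\<dots> \<le> 2 * \<epsilon> * (b * (sqrt (v t) * sqrt (u t))) + 2 * (- \<kappa> * v t)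
        + 2 * \<epsilon> * (b * (sqrt (v t) * sqrt (v t)))"
      using mult_right_mono[OF \<kappa>(3) uv0(2)[of t]] by simp
    finally show ?thesis using uv0(2)[of t] by (simp add: mult_ac)
  qed
  have du: "(u has_real_derivative u' t) (at t within {p..<q})" if "t \<in> {p..<q}" for t
    using quadratic_form_derivative[OF Qs(1) dx[OF that]] by (simp add: u_def[abs_def] u'_def)
  have dv: "(v has_real_derivative v' t) (at t within {p..<q})" if "t \<in> {p..<q}" for t
    using quadratic_form_derivative[OF Qf(1) dy[OF that]] by (simp add: v_def[abs_def] v'_def)
  have Ke0: "0 \<le> K * \<epsilon>" using e unfolding K by simp
  have "u t \<le> u p + (sqrt (K * \<epsilon>))\<^sup>2 * v p"
    and "v t \<le> (1 + (sqrt (K * \<epsilon>))\<^sup>2) * v p + (sqrt (K * \<epsilon>))\<^sup>2 * u p"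
    unfolding real_sqrt_pow2[OF Ke0]
    by (rule flow_bounds[OF \<kappa>(1) e b0 K Ke be uv0 du dv u'b v'b t]; assumption)+
  from weighted_growth[OF qnorm_nonneg[OF Qs(2)] qnorm_nonneg[OF Qf(2)] real_sqrt_ge_zero[OF Ke0] \<beta>
      qnorm_nonneg[OF Qs(2)] qnorm_nonneg[OF Qf(2)] this[unfolded uq vq]]
  show ?thesis .
qed

section \<open>From contraction at events to stability\<close>

text \<open>Since the event times are unbounded, every time lies in some interval between events,
  and late times lie in intervals of large index; decay in \<open>k\<close> thus becomes convergence
  in \<open>t\<close>. Stability follows because \<open>C\<close> is the same for all
  solutions.\<close>

lemma gas_from_geometric_decay:
  assumes T: "event_times T" and \<eta>: "0 \<le> \<eta>" "\<eta> < 1" and C: "C > 0"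
    and bound: "\<And>x y k t. is_solution \<epsilon> A R T \<sigma> \<nu> x y \<Longrightarrow> t \<in> {T k..<T (Suc k)} \<Longrightarrow>
      norm (join (x t) (y t)) \<le> C * \<eta> ^ k * norm (join (x 0) (y 0))"
  shows "globally_asymptotically_stable \<epsilon> A R T \<sigma> \<nu>"
proof -
  have T0: "T 0 = 0" and mono: "strict_mono T" and unb: "\<not> bdd_above (range T)"
    using T by (auto simp: event_times_def)
  have cover: "\<exists>k\<ge>N. t \<in> {T k..<T (Suc k)}" if "T N \<le> t" for t N
  proof -
    obtain n where n: "t < T n" using unb by (metis bdd_above.I2 not_le)
    \<comment> \<open>The interval containing \<open>t\<close> ends at the first event after
      \<open>t\<close>, so \<open>k\<close> is the predecessor of \<open>m\<close>.\<close>
    define m where "m = (LEAST n. t < T n)"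
    have m: "t < T m" unfolding m_def using n by (rule LeastI)
    hence "N < m" using that mono by (metis le_less_trans strict_mono_less)
    then obtain k where k: "m = Suc k" by (cases m) auto
    hence "T k \<le> t" using not_less_Least[of k "\<lambda>n. t < T n"] by (auto simp flip: m_def)
    thus ?thesis using k m \<open>N < m\<close> by (intro exI[of _ k]) auto
  qed
  show ?thesis unfolding globally_asymptotically_stable_def
  proof (intro conjI allI impI)
    fix \<rho> :: real assume \<rho>: "\<rho> > 0"
    show "\<exists>\<delta>>0. \<forall>x y. is_solution \<epsilon> A R T \<sigma> \<nu> x y \<longrightarrow> norm (join (x 0) (y 0)) < \<delta> \<longrightarrow>
        (\<forall>t\<ge>0. norm (join (x t) (y t)) < \<rho>)"
    proof (intro exI[of _ "\<rho> / C"] conjI allI impI)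
      fix x y t assume sol: "is_solution \<epsilon> A R T \<sigma> \<nu> x y" and n: "norm (join (x 0) (y 0)) < \<rho> / C"
        and t: "(t::real) \<ge> 0"
      obtain k where "t \<in> {T k..<T (Suc k)}" using cover[of 0 t] t T0 by auto
      from bound[OF sol this] have "norm (join (x t) (y t)) \<le> C * \<eta> ^ k * norm (join (x 0) (y 0))" .
      also have "\<dots> \<le> C * 1 * norm (join (x 0) (y 0))"
        using C \<eta> by (intro mult_right_mono mult_left_mono power_le_one) auto
      also have "\<dots> < \<rho>" using n C by (simp add: field_simps)
      finally show "norm (join (x t) (y t)) < \<rho>" .
    qed (use \<rho> C in auto)
  next
    fix x y assume sol: "is_solution \<epsilon> A R T \<sigma> \<nu> x y"
    show "((\<lambda>t. join (x t) (y t)) \<longlongrightarrow> 0) at_top"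
    proof (rule tendstoI)
      fix \<rho> :: real assume \<rho>: "\<rho> > 0"
      have "(\<lambda>k. C * \<eta> ^ k * norm (join (x 0) (y 0))) \<longlonglongrightarrow> C * 0 * norm (join (x 0) (y 0))"
        using \<eta> by (intro tendsto_intros LIMSEQ_power_zero) auto
      hence "\<forall>\<^sub>F k in sequentially. C * \<eta> ^ k * norm (join (x 0) (y 0)) < \<rho>"
        using \<rho> by (intro order_tendstoD) auto
      then obtain N where N: "\<And>k. k \<ge> N \<Longrightarrow> C * \<eta> ^ k * norm (join (x 0) (y 0)) < \<rho>"
        by (auto simp: eventually_sequentially)
      have "dist (join (x t) (y t)) 0 < \<rho>" if "t \<ge> T N" for t
      proof -
        obtain k where "k \<ge> N" "t \<in> {T k..<T (Suc k)}" using cover \<open>t \<ge> T N\<close> by blast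
        thus ?thesis using bound[OF sol, of t k] N[of k] by simp
      qed
      thus "\<forall>\<^sub>F t in at_top. dist (join (x t) (y t)) 0 < \<rho>"
        unfolding eventually_at_top_linorder by blast
    qed
  qed
qed

text \<open>The triangle inequality bounds both new norms by the gain matrix applied to the old
  ones; the hypotheses on \<open>\<theta>\<close> compare the columns of that matrix, weighted by
  (1, \<beta>).\<close>

lemma jump_contraction:
  assumes g: "qnorm Qs' (block11 R *v x) \<le> g11 * qnorm Qs x" "qnorm Qs' (block12 R *v y) \<le> g12 * qnorm Qf y"
      "qnorm Qf' (block21 R *v x) \<le> g21 * qnorm Qs x" "qnorm Qf' (block22 R *v y) \<le> g22 * qnorm Qf y"
    and Q: "symmetric_matrix Qs'" "loewner_le (mat 1) Qs'" "symmetric_matrix Qf'" "loewner_le (mat 1) Qf'"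
      "loewner_le (mat 1) Qs" "loewner_le (mat 1) Qf"
    and \<beta>: "\<beta> > 0" and \<theta>: "g11 + \<beta> * g21 \<le> \<theta>" "g12 + \<beta> * g22 \<le> \<theta> * \<beta>"
    and eq: "join x' y' = R *v join x y"
  shows "qnorm Qs' x' + \<beta> * qnorm Qf' y' \<le> \<theta> * (qnorm Qs x + \<beta> * qnorm Qf y)"
proof -
  have xy: "x' = block11 R *v x + block12 R *v y" "y' = block21 R *v x + block22 R *v y"
    using eq by (auto simp: matrix_vector_mult_join join_eq_iff)
  have "qnorm Qs' x' \<le> g11 * qnorm Qs x + g12 * qnorm Qf y"
    unfolding xy by (rule order_trans[OF qnorm_triangle[OF Q(1,2)] add_mono[OF g(1,2)]])
  moreover have "qnorm Qf' y' \<le> g21 * qnorm Qs x + g22 * qnorm Qf y"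
    unfolding xy by (rule order_trans[OF qnorm_triangle[OF Q(3,4)] add_mono[OF g(3,4)]])
  ultimately have "qnorm Qs' x' + \<beta> * qnorm Qf' y'
      \<le> (g11 * qnorm Qs x + g12 * qnorm Qf y) + \<beta> * (g21 * qnorm Qs x + g22 * qnorm Qf y)"
    using \<beta> by (intro add_mono mult_left_mono) auto
  also have "\<dots> = (g11 + \<beta> * g21) * qnorm Qs x + (g12 + \<beta> * g22) * qnorm Qf y"
    by (simp add: algebra_simps)
  also have "\<dots> \<le> \<theta> * qnorm Qs x + \<theta> * \<beta> * qnorm Qf y"
    using Q \<theta> by (intro add_mono mult_right_mono qnorm_nonneg) auto
  finally show ?thesis by (simp add: algebra_simps)
qed

section \<open>Uniform constants and the stability theorem\<close>

theorem theorem12: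
  fixes I :: "'i set" and J :: "'j set"
    and fast :: "'i \<Rightarrow> ('x::finite + 'z::finite) set"
    and S \<A> :: "'i \<Rightarrow> real^('x + 'z)^('x + 'z)"
    and \<J> :: "'j \<Rightarrow> real^('x + 'z)^('x + 'z)"
    and Q\<^sub>s :: "'i \<Rightarrow> real^'x^'x" and Q\<^sub>f :: "'i \<Rightarrow> real^'z^'z"
    and \<kappa>\<^sub>s \<kappa>\<^sub>f :: "'i \<Rightarrow> real"
    and \<gamma>\<^sub>1\<^sub>1 \<gamma>\<^sub>1\<^sub>2 \<gamma>\<^sub>2\<^sub>1 \<gamma>\<^sub>2\<^sub>2 :: real
  assumes "finite I" and "I \<noteq> {}" and "finite J" and "J \<noteq> {}"
    and "\<And>i. i \<in> I \<Longrightarrow> card (fast i) = CARD('z)"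
    and "\<And>i. i \<in> I \<Longrightarrow> permutation_matrix (S i)"
    and "\<And>i \<epsilon>. i \<in> I \<Longrightarrow> \<epsilon> > 0 \<Longrightarrow>
           S i ** scaling_matrix (fast i) \<epsilon> ** transpose (S i)
             = from_blocks (mat 1) 0 0 (\<epsilon> *\<^sub>R mat 1)"
    and "\<And>i. i \<in> I \<Longrightarrow> invertible (block22 (mode_mat S \<A> i))"
    and "\<And>i. i \<in> I \<Longrightarrow> Hurwitz (A0_mat (mode_mat S \<A> i))"
    and "\<And>i. i \<in> I \<Longrightarrow> Hurwitz (block22 (mode_mat S \<A> i))"
    and "\<And>i. i \<in> I \<Longrightarrow> symmetric_matrix (Q\<^sub>s i) \<and> loewner_le (mat 1) (Q\<^sub>s i)"
    and "\<And>i. i \<in> I \<Longrightarrow> symmetric_matrix (Q\<^sub>f i) \<and> loewner_le (mat 1) (Q\<^sub>f i)"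
    and "\<And>i. i \<in> I \<Longrightarrow> \<kappa>\<^sub>s i > 0 \<and> \<kappa>\<^sub>f i > 0"
    and "\<And>i. i \<in> I \<Longrightarrow>
           loewner_le (transpose (A0_mat (mode_mat S \<A> i)) ** Q\<^sub>s i
                         + Q\<^sub>s i ** A0_mat (mode_mat S \<A> i))
                      ((- 2 * \<kappa>\<^sub>s i) *\<^sub>R Q\<^sub>s i)"
    and "\<And>i. i \<in> I \<Longrightarrow>
           loewner_le (transpose (block22 (mode_mat S \<A> i)) ** Q\<^sub>f i
                         + Q\<^sub>f i ** block22 (mode_mat S \<A> i))
                      ((- 2 * \<kappa>\<^sub>f i) *\<^sub>R Q\<^sub>f i)"
    and "\<gamma>\<^sub>1\<^sub>1 = jump_gain I J Q\<^sub>s Q\<^sub>s (\<lambda>i j i'. block11 (R_mat S \<A> \<J> i j i'))"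
    and "\<gamma>\<^sub>1\<^sub>2 = jump_gain I J Q\<^sub>s Q\<^sub>f (\<lambda>i j i'. block12 (R_mat S \<A> \<J> i j i'))"
    and "\<gamma>\<^sub>2\<^sub>1 = jump_gain I J Q\<^sub>f Q\<^sub>s (\<lambda>i j i'. block21 (R_mat S \<A> \<J> i j i'))"
    and "\<gamma>\<^sub>2\<^sub>2 = jump_gain I J Q\<^sub>f Q\<^sub>f (\<lambda>i j i'. block22 (R_mat S \<A> \<J> i j i'))"
    and "\<gamma>\<^sub>1\<^sub>1 < 1" and "\<gamma>\<^sub>2\<^sub>2 < 1"
    and "\<gamma>\<^sub>1\<^sub>2 * \<gamma>\<^sub>2\<^sub>1 / ((1 - \<gamma>\<^sub>1\<^sub>1) * (1 - \<gamma>\<^sub>2\<^sub>2)) < 1"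
  shows "\<exists>\<epsilon>\<^sub>5>0. \<forall>\<epsilon>. 0 < \<epsilon> \<and> \<epsilon> < \<epsilon>\<^sub>5 \<longrightarrow>
           (\<forall>T \<sigma> \<nu>. event_times T \<longrightarrow> (\<forall>k. \<sigma> k \<in> I) \<longrightarrow> (\<forall>k\<ge>1. \<nu> k \<in> J) \<longrightarrow>
              globally_asymptotically_stable \<epsilon> (mode_mat S \<A>) (R_mat S \<A> \<J>) T \<sigma> \<nu>)"
proof -
  note I = assms(1) and J = assms(3) and symQs = assms(11)[THEN conjunct1]
    and geQs = assms(11)[THEN conjunct2] and symQf = assms(12)[THEN conjunct1]
    and geQf = assms(12)[THEN conjunct2] and slow = assms(14) and fast = assms(15)
  let ?A = "mode_mat S \<A>" and ?R = "R_mat S \<A> \<J>"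
  obtain i0 j0 where i0: "i0 \<in> I" and j0: "j0 \<in> J" using assms(2,4) by blast
  have \<gamma>0: "0 \<le> \<gamma>\<^sub>1\<^sub>1" "0 \<le> \<gamma>\<^sub>1\<^sub>2" "0 \<le> \<gamma>\<^sub>2\<^sub>1" "0 \<le> \<gamma>\<^sub>2\<^sub>2"
    unfolding assms(16-19)
    by (rule jump_gain_nonneg[OF I J i0 j0])+
  obtain \<beta> \<theta> where \<beta>: "\<beta> > 0" and \<theta>0: "0 \<le> \<theta>" and \<theta>1: "\<theta> < 1"
    and \<theta>: "\<gamma>\<^sub>1\<^sub>1 + \<beta> * \<gamma>\<^sub>2\<^sub>1 \<le> \<theta>" "\<gamma>\<^sub>1\<^sub>2 + \<beta> * \<gamma>\<^sub>2\<^sub>2 \<le> \<theta> * \<beta>"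
    using small_gain_weights[OF \<gamma>0(2,3) assms(20,21) \<gamma>0(1,4) assms(22)] by blast
  define \<kappa> where "\<kappa> = Min (\<kappa>\<^sub>s ` I \<union> \<kappa>\<^sub>f ` I)"
  have \<kappa>: "0 < \<kappa>" "\<And>i. i \<in> I \<Longrightarrow> \<kappa> \<le> \<kappa>\<^sub>s i" "\<And>i. i \<in> I \<Longrightarrow> \<kappa> \<le> \<kappa>\<^sub>f i"
    using I assms(2,13) by (auto simp: \<kappa>_def)
  define nb where "nb i = Max {spectral_norm (Q\<^sub>s i ** B1_mat (?A i)),
      spectral_norm (Q\<^sub>f i ** B2_mat (?A i)), spectral_norm (Q\<^sub>f i ** B3_mat (?A i))}" for i
  \<comment> \<open>Inserting 0 makes nonnegativity of the common bound immediate.\<close>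
  define b where "b = Max (insert 0 (nb ` I))"
  have b0: "0 \<le> b" using I by (simp add: b_def)
  have nb: "nb i \<le> b" if "i \<in> I" for i using I that by (simp add: b_def)
  have b: "spectral_norm (Q\<^sub>s i ** B1_mat (?A i)) \<le> b" "spectral_norm (Q\<^sub>f i ** B2_mat (?A i)) \<le> b"
    "spectral_norm (Q\<^sub>f i ** B3_mat (?A i)) \<le> b" if "i \<in> I" for i
    using nb[OF that] by (simp_all add: nb_def)
  define K where "K = 2 * b\<^sup>2 / \<kappa>\<^sup>2 + 1"
  have K0: "K > 0" by (simp add: K_def add_nonneg_pos)
  define c where "c = \<beta> + 1 + 1 / \<beta>"
  have c0: "c > 0" using \<beta> by (simp add: c_def add_pos_pos)
  \<comment> \<open>If sqrt (K \<epsilon>) \<le> r, the flow factor 1 + c sqrt (K \<epsilon>) is at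
    most 1 + (1 - \<theta>) / 2.\<close>
  define r where "r = (1 - \<theta>) / (2 * c)"
  have r0: "r > 0" using \<theta>1 c0 by (simp add: r_def)
  \<comment> \<open>The entries ensure in turn \<open>Ke\<close>, \<open>be\<close> and
    \<open>Kr\<close>; b + 1 replaces b to avoid a zero denominator.\<close>
  define \<epsilon>5 where "\<epsilon>5 = Min {1 / K, \<kappa> / (4 * (b + 1)), r\<^sup>2 / K}"
  have "\<epsilon>5 > 0" using K0 \<kappa>(1) b0 r0 by (simp add: \<epsilon>5_def)
  moreover have "globally_asymptotically_stable \<epsilon> ?A ?R T \<sigma> \<nu>"
    if e: "0 < \<epsilon>" "\<epsilon> < \<epsilon>5" and T: "event_times T" and \<sigma>: "\<And>k. \<sigma> k \<in> I"
      and \<nu>: "\<And>k. k \<ge> 1 \<Longrightarrow> \<nu> k \<in> J" for \<epsilon> T \<sigma> \<nu>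
  proof -
    have Ke: "K * \<epsilon> \<le> 1" and Kr: "K * \<epsilon> \<le> r\<^sup>2" and be: "b * \<epsilon> \<le> \<kappa> / 4"
    proof -
      have e5: "\<epsilon> < 1 / K" "\<epsilon> < r\<^sup>2 / K" "\<epsilon> < \<kappa> / (4 * (b + 1))"
        using e(2) by (simp_all add: \<epsilon>5_def)
      show "K * \<epsilon> \<le> 1" "K * \<epsilon> \<le> r\<^sup>2" using e5(1,2) K0 by (simp_all add: field_simps)
      have "(b + 1) * \<epsilon> \<le> \<kappa> / 4" using e5(3) b0 by (simp add: field_simps)
      thus "b * \<epsilon> \<le> \<kappa> / 4" using e(1) by (simp add: algebra_simps)
    qed
    define g where "g = 1 + sqrt (K * \<epsilon>) * c"
    \<comment> \<open>The midpoint of \<theta> and 1 dominates \<theta> g, because \<theta> (1 + (1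
      - \<theta>) / 2) \<le> \<theta> + (1 - \<theta>) / 2.\<close>
    define \<eta> where "\<eta> = (1 + \<theta>) / 2"
    have \<eta>: "0 \<le> \<eta>" "\<eta> < 1" using \<theta>0 \<theta>1 by (simp_all add: \<eta>_def)
    have "sqrt (K * \<epsilon>) \<le> r" using Kr r0 by (simp add: real_le_lsqrt)
    hence "sqrt (K * \<epsilon>) * c \<le> r * c" using c0 by simp
    also have "\<dots> = (1 - \<theta>) / 2" using c0 by (simp add: r_def)
    finally have g: "g \<le> 1 + (1 - \<theta>) / 2" by (simp add: g_def)
    have g0: "g \<ge> 0" using K0 e c0 by (simp add: g_def)
    have g2: "g \<le> 2" using g \<theta>0 by (simp add: field_simps)
    have "\<theta> * g \<le> \<theta> * (1 + (1 - \<theta>) / 2)" using g \<theta>0 by (rule mult_left_mono)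
    also have "\<dots> = \<theta> + \<theta> * ((1 - \<theta>) / 2)" by (simp add: algebra_simps)
    also have "\<dots> \<le> \<theta> + 1 * ((1 - \<theta>) / 2)" using \<theta>1 by (intro add_left_mono mult_right_mono) auto
    finally have g\<eta>: "\<theta> * g \<le> \<eta>" by (simp add: \<eta>_def field_simps)
    \<comment> \<open>\<open>C0\<close> compares the initial weighted sum with the Euclidean norm
      and depends only on the first mode. In \<open>C\<close>, the factor 1 + 1/\<beta> leads back
      to the Euclidean norm, 2 bounds \<open>g\<close>, and \<bar>C0\<bar> + 1 is positive.\<close>
    define C0 where "C0 = sqrt (spectral_norm (Q\<^sub>s (\<sigma> 0))) + \<beta> * sqrt (spectral_norm (Q\<^sub>f (\<sigma> 0)))"
    define C where "C = (1 + 1 / \<beta>) * (2 * (\<bar>C0\<bar> + 1))"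
    have C: "C > 0" unfolding C_def using \<beta> by (intro mult_pos_pos) (auto intro: add_pos_pos add_nonneg_pos)
    show ?thesis
    proof (rule gas_from_geometric_decay[OF T \<eta> C])
      fix x :: "real \<Rightarrow> real^'x" and y :: "real \<Rightarrow> real^'z" and k t
      assume sol: "is_solution \<epsilon> ?A ?R T \<sigma> \<nu> x y" and t: "t \<in> {T k..<T (Suc k)}"
      \<comment> \<open>The weights change with the mode, so \<open>W\<close> carries the index of
        the interval besides the time.\<close>
      define W where "W k t = qnorm (Q\<^sub>s (\<sigma> k)) (x t) + \<beta> * qnorm (Q\<^sub>f (\<sigma> k)) (y t)" for k t
      have W0: "0 \<le> W k t" for k t
        using \<beta> by (simp add: W_def qnorm_nonneg[OF geQs[OF \<sigma>]] qnorm_nonneg[OF geQf[OF \<sigma>]])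
      have flow: "W k t \<le> g * W k (T k)" if "t \<in> {T k..<T (Suc k)}" for k t
        unfolding W_def g_def c_def
      proof (rule mode_flow_bound[OF symQs[OF \<sigma>] geQs[OF \<sigma>] symQf[OF \<sigma>] geQf[OF \<sigma>]
            slow[OF \<sigma>] fast[OF \<sigma>] \<kappa>(1) \<kappa>(2,3)[OF \<sigma>] b[OF \<sigma>] e(1) K_def Ke be \<beta> _ that])
        show "\<forall>t \<in> {T k..<T (Suc k)}. \<exists>x' y'.
          (x has_vector_derivative x') (at t within {T k..<T (Suc k)}) \<and>
          (y has_vector_derivative y') (at t within {T k..<T (Suc k)}) \<and>
          x' = A0_mat (?A (\<sigma> k)) *v x t + B1_mat (?A (\<sigma> k)) *v y t \<and>
          \<epsilon> *\<^sub>R y' = (\<epsilon> *\<^sub>R B2_mat (?A (\<sigma> k))) *v x t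
                  + (block22 (?A (\<sigma> k)) + \<epsilon> *\<^sub>R B3_mat (?A (\<sigma> k))) *v y t"
          using sol unfolding is_solution_def by blast
      qed
      have jump: "W (Suc k) (T (Suc k)) \<le> \<eta> * W k (T k)" for k
      proof -
        obtain xm ym where xm: "(x \<longlongrightarrow> xm) (at_left (T (Suc k)))"
          and ym: "(y \<longlongrightarrow> ym) (at_left (T (Suc k)))"
          and eq: "join (x (T (Suc k))) (y (T (Suc k))) = ?R (\<sigma> k) (\<nu> (Suc k)) (\<sigma> (Suc k)) *v join xm ym"
          using sol unfolding is_solution_def by (metis diff_Suc_1 le_add1 plus_1_eq_Suc)
        define M where "M = qnorm (Q\<^sub>s (\<sigma> k)) xm + \<beta> * qnorm (Q\<^sub>f (\<sigma> k)) ym"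
        have \<nu>J: "\<nu> (Suc k) \<in> J" using \<nu> by simp
        \<comment> \<open>The half-open interval excludes the event, so the flow bound reaches the
          state before the jump through the left limit.\<close>
        have "T k < T (Suc k)" using T by (simp add: event_times_def strict_mono_less)
        hence "\<forall>\<^sub>F t in at_left (T (Suc k)). t \<in> {T k..<T (Suc k)}"
          unfolding eventually_at_left[OF \<open>T k < T (Suc k)\<close>] by (intro exI[of _ "T k"]) auto
        hence "\<forall>\<^sub>F t in at_left (T (Suc k)). W k t \<le> g * W k (T k)"
          by (rule eventually_mono) (rule flow)
        moreover have "(W k \<longlongrightarrow> M) (at_left (T (Suc k)))"
          unfolding M_def W_def[abs_def] by (intro tendsto_intros tendsto_qnorm xm ym)
        ultimately have M: "M \<le> g * W k (T k)"
          by (intro tendsto_upperbound) auto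
        have "W (Suc k) (T (Suc k)) \<le> \<theta> * M"
          unfolding W_def M_def
        proof (rule jump_contraction[OF _ _ _ _ symQs[OF \<sigma>] geQs[OF \<sigma>] symQf[OF \<sigma>] geQf[OF \<sigma>]
              geQs[OF \<sigma>] geQf[OF \<sigma>] \<beta> \<theta> eq])
          let ?Rk = "?R (\<sigma> k) (\<nu> (Suc k)) (\<sigma> (Suc k))"
          show "qnorm (Q\<^sub>s (\<sigma> (Suc k))) (block11 ?Rk *v xm) \<le> \<gamma>\<^sub>1\<^sub>1 * qnorm (Q\<^sub>s (\<sigma> k)) xm"
            unfolding assms(16) by (rule jump_gain_bound[OF I J \<sigma> \<nu>J \<sigma>]) (intro symQs geQs symQf geQf \<sigma>)+
          show "qnorm (Q\<^sub>s (\<sigma> (Suc k))) (block12 ?Rk *v ym) \<le> \<gamma>\<^sub>1\<^sub>2 * qnorm (Q\<^sub>f (\<sigma> k)) ym"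
            unfolding assms(17) by (rule jump_gain_bound[OF I J \<sigma> \<nu>J \<sigma>]) (intro symQs geQs symQf geQf \<sigma>)+
          show "qnorm (Q\<^sub>f (\<sigma> (Suc k))) (block21 ?Rk *v xm) \<le> \<gamma>\<^sub>2\<^sub>1 * qnorm (Q\<^sub>s (\<sigma> k)) xm"
            unfolding assms(18) by (rule jump_gain_bound[OF I J \<sigma> \<nu>J \<sigma>]) (intro symQs geQs symQf geQf \<sigma>)+
          show "qnorm (Q\<^sub>f (\<sigma> (Suc k))) (block22 ?Rk *v ym) \<le> \<gamma>\<^sub>2\<^sub>2 * qnorm (Q\<^sub>f (\<sigma> k)) ym"
            unfolding assms(19) by (rule jump_gain_bound[OF I J \<sigma> \<nu>J \<sigma>]) (intro symQs geQs symQf geQf \<sigma>)+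
        qed
        also have "\<dots> \<le> \<theta> * (g * W k (T k))" using M \<theta>0 by (rule mult_left_mono)
        also have "\<dots> \<le> \<eta> * W k (T k)"
          using mult_right_mono[OF g\<eta> W0] by (simp add: mult_ac)
        finally show ?thesis .
      qed
      have decay: "W k (T k) \<le> \<eta> ^ k * W 0 0" for k
      proof (induction k)
        case 0
        show ?case using T by (simp add: event_times_def)
      next
        case (Suc k)
        have "W (Suc k) (T (Suc k)) \<le> \<eta> * (\<eta> ^ k * W 0 0)"
          using jump[of k] mult_left_mono[OF Suc.IH \<eta>(1)] by linarith
        thus ?case by (simp add: mult_ac)
      qed
      let ?n0 = "norm (join (x 0) (y 0))"
      have W00: "W 0 0 \<le> (\<bar>C0\<bar> + 1) * ?n0"
      proof -
        have "norm (x 0) \<le> ?n0" "norm (y 0) \<le> ?n0"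
          by (simp_all add: norm_join real_le_rsqrt)
        hence "qnorm (Q\<^sub>s (\<sigma> 0)) (x 0) \<le> sqrt (spectral_norm (Q\<^sub>s (\<sigma> 0))) * ?n0"
          "qnorm (Q\<^sub>f (\<sigma> 0)) (y 0) \<le> sqrt (spectral_norm (Q\<^sub>f (\<sigma> 0))) * ?n0"
          by (auto intro!: order_trans[OF qnorm_le_norm] mult_left_mono simp: spectral_norm_nonneg)
        hence "W 0 0 \<le> sqrt (spectral_norm (Q\<^sub>s (\<sigma> 0))) * ?n0 + \<beta> * (sqrt (spectral_norm (Q\<^sub>f (\<sigma> 0))) * ?n0)"
          unfolding W_def using \<beta> by (intro add_mono mult_left_mono) auto
        also have "\<dots> = C0 * ?n0" by (simp add: C0_def algebra_simps)
        also have "\<dots> \<le> (\<bar>C0\<bar> + 1) * ?n0" by (intro mult_right_mono) auto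
        finally show ?thesis .
      qed
      have "norm (join (x t) (y t)) \<le> norm (x t) + norm (y t)"
        by (simp add: norm_join sqrt_sum_squares_le_sum)
      also have "\<dots> \<le> qnorm (Q\<^sub>s (\<sigma> k)) (x t) + qnorm (Q\<^sub>f (\<sigma> k)) (y t)"
        by (intro add_mono norm_le_qnorm geQs geQf \<sigma>)
      \<comment> \<open>The added terms complete the sum to a multiple of \<open>W k t\<close>,
        whether \<beta> is above or below 1.\<close>
      also have "\<dots> \<le> \<dots> + (\<beta> * qnorm (Q\<^sub>f (\<sigma> k)) (y t) + qnorm (Q\<^sub>s (\<sigma> k)) (x t) / \<beta>)"
        using \<beta> qnorm_nonneg[OF geQs[OF \<sigma>]] qnorm_nonneg[OF geQf[OF \<sigma>]] by simp
      also have "\<dots> = (1 + 1 / \<beta>) * W k t" using \<beta> by (simp add: W_def field_simps)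
      also have "\<dots> \<le> (1 + 1 / \<beta>) * (2 * (\<eta> ^ k * ((\<bar>C0\<bar> + 1) * ?n0)))"
      proof (rule mult_left_mono)
        have "W k t \<le> g * W k (T k)" by (rule flow[OF t])
        also have "\<dots> \<le> 2 * (\<eta> ^ k * ((\<bar>C0\<bar> + 1) * ?n0))"
          by (intro mult_mono g2 order_trans[OF decay] mult_left_mono W00 W0) (use \<eta> in auto)
        finally show "W k t \<le> 2 * (\<eta> ^ k * ((\<bar>C0\<bar> + 1) * ?n0))" .
      qed (use \<beta> in auto)
      also have "\<dots> = C * \<eta> ^ k * ?n0" by (simp add: C_def mult_ac)
      finally show "norm (join (x t) (y t)) \<le> C * \<eta> ^ k * ?n0" .
    qed
  qed
  ultimately show ?thesis by blast
qed

end
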